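(* Let $(\Lambda V,d)$ be a Sullivan minimal algebra over $\mathbb{Q}$ with $V=V^{\geq 2}$ of finite type. Suppose that $\theta_1,\theta_2\in\mathrm{Der}'(\Lambda V)$ are (homogeneous) cycles with $L_{-1}(\theta_1),L_{-1}(\theta_2)$ linearly independent, and that $\mathrm{Der}'(\Lambda V)$ satisfies the condition $(\mathrm{G}_k)$ for all $k$ with $1\leq k\leq|\theta_1|-2$ and for all $k$ with $|\theta_2|-|\theta_1|\leq k\leq|\theta_2|-2$. Then $|\theta_1|=|\theta_2|$ and $V^{<|\theta_1|}=0$.
   Context: $\Lambda V$ is the free graded-commutative algebra on the graded vector space $V$, and the differential $d$ (of degree $+1$) is decomposable. $\mathrm{Der}_k(\Lambda V)$ is the space of derivations of $\Lambda V$ lowering degree by $k$, i.e. linear maps $\theta$ of degree $-k$ with $\theta(xy)=\theta(x)y+(-1)^{k|x|}x\theta(y)$; we write $|\theta|=k$ and call $k$ the degree of $\theta$. $\mathrm{Der}(\Lambda V)$ is a differential graded Lie algebra with $[\theta_1,\theta_2]=\theta_1\theta_2-(-1)^{|\theta_1||\theta_2|}\theta_2\theta_1$ and $D(\theta)=[d,\theta]$. The sub-DGL $\mathrm{Der}'(\Lambda V)$ is given by $\mathrm{Der}'_k=\mathrm{Der}_k$ for $k>1$, $\mathrm{Der}'_1=$ the $D$-cycles in $\mathrm{Der}_1$, and $\mathrm{Der}'_k=0$ for $k<1$. $\Lambda V=\bigoplus_{l\geq 0}\Lambda^lV$ by wordlength. Via $\mathrm{Der}(\Lambda V)\cong\mathrm{Hom}(V,\Lambda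 V)$, each derivation decomposes as $\theta=\theta_{-1}+\theta_0+\theta_1+\cdots$ with $\theta_l\in\mathrm{Hom}(V,\Lambda^{l+1}V)$; put $L_l(\theta)=\theta_l$. In particular $L_{-1}(\theta)\in\mathrm{Hom}(V,\mathbb{Q})$. Condition $(\mathrm{G}_k)$, for an integer $k$: every cycle $\theta\in\mathrm{Der}'_k(\Lambda V)$ with $L_{-1}(\theta)=0$ is exact, i.e. a boundary in $\mathrm{Der}'(\Lambda V)$. $V^{<p}$ denotes the part of $V$ in degrees less than $p$. *)

theory Defs
  imports Complex_Main "HOL-Library.Poly_Mapping"
begin

text \<open>
  Conventions. The algebra \<open>\<Lambda>V\<close> is carried by a whole type \<open>'a :: ring_1\<close> with scalar
  multiplication \<open>s :: rat \<Rightarrow> 'a \<Rightarrow> 'a\<close>. The graded vector space \<open>V\<close> is a family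
  \<open>V :: int \<Rightarrow> 'a set\<close> of subspaces, \<open>V n\<close> being the part of degree \<open>n\<close>, sitting inside
  \<open>\<Lambda>V\<close> as the generators.
\<close>

locale rat_algebra = vector_space s
  for s :: "rat \<Rightarrow> 'a::ring_1 \<Rightarrow> 'a" +
  assumes scale_mult_left: "s c x * y = s c (x * y)"
    and scale_mult_right: "x * s c y = s c (x * y)"

definition koszul_sign :: "int \<Rightarrow> int \<Rightarrow> 'b::ring_1" where
  "koszul_sign m n = (if odd m \<and> odd n then -1 else 1)"

section \<open>Free graded-commutative algebras\<close>

text \<open>
  A word is a list of pairs \<open>(n, x)\<close> with \<open>x \<in> V n\<close>. Finitely supported rational combinations
  of words form the free associative algebra on the homogeneous elements of \<open>V\<close>. Letters carry
  their degree, so that elements of different \<open>V n\<close> are kept apart: this is the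
  external direct sum of the \<open>V n\<close>.
\<close>

definition words :: "(int \<Rightarrow> 'a set) \<Rightarrow> (int \<times> 'a) list set" where
  "words V = {w. \<forall>(n, x)\<in>set w. x \<in> V n}"

definition word_degree :: "(int \<times> 'a) list \<Rightarrow> int" where
  "word_degree w = sum_list (map fst w)"

definition word_prod :: "(int \<times> 'a::ring_1) list \<Rightarrow> 'a" where
  "word_prod w = prod_list (map snd w)"

definition eval_words ::
    "(rat \<Rightarrow> 'a::ring_1 \<Rightarrow> 'a) \<Rightarrow> ((int \<times> 'a) list \<Rightarrow>\<^sub>0 rat) \<Rightarrow> 'a" where
  "eval_words s f = (\<Sum>w\<in>Poly_Mapping.keys f. s (Poly_Mapping.lookup f w) (word_prod w))"

text \<open>
  The two-sided ideal generated by the linearity relations (dividing these out yields the tensor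
  algebra \<open>TV\<close>) and by \<open>x \<otimes> y - (-1)\<^bsup>|x||y|\<^esup> y \<otimes> x\<close> for homogeneous \<open>x, y\<close>. It is the set
  of sums of rational multiples of relations multiplied by words on both sides.
\<close>

inductive_set koszul_ideal ::
    "(rat \<Rightarrow> 'a::ring_1 \<Rightarrow> 'a) \<Rightarrow> (int \<Rightarrow> 'a set) \<Rightarrow> ((int \<times> 'a) list \<Rightarrow>\<^sub>0 rat) set"
  for s V where
  zero: "0 \<in> koszul_ideal s V"
| add: "f \<in> koszul_ideal s V \<Longrightarrow> g \<in> koszul_ideal s V \<Longrightarrow> f + g \<in> koszul_ideal s V"
| rel_add: "u \<in> words V \<Longrightarrow> w \<in> words V \<Longrightarrow> x \<in> V n \<Longrightarrow> y \<in> V n \<Longrightarrow>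
    Poly_Mapping.single (u @ [(n, x + y)] @ w) c
      - Poly_Mapping.single (u @ [(n, x)] @ w) c
      - Poly_Mapping.single (u @ [(n, y)] @ w) c \<in> koszul_ideal s V"
| rel_scale: "u \<in> words V \<Longrightarrow> w \<in> words V \<Longrightarrow> x \<in> V n \<Longrightarrow>
    Poly_Mapping.single (u @ [(n, s r x)] @ w) c
      - Poly_Mapping.single (u @ [(n, x)] @ w) (c * r) \<in> koszul_ideal s V"
| rel_comm: "u \<in> words V \<Longrightarrow> w \<in> words V \<Longrightarrow> x \<in> V m \<Longrightarrow> y \<in> V n \<Longrightarrow>
    Poly_Mapping.single (u @ [(m, x), (n, y)] @ w) c
      - Poly_Mapping.single (u @ [(n, y), (m, x)] @ w) (c * koszul_sign m n) \<in> koszul_ideal s V"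

text \<open>
  The algebra is \<open>\<Lambda>V = TV / (x \<otimes> y - (-1)\<^bsup>|x||y|\<^esup> y \<otimes> x)\<close>: the multiplicative extension of
  the inclusions of the \<open>V n\<close> is surjective and its kernel is exactly the ideal of relations.
\<close>

locale free_graded_commutative = rat_algebra s
  for s :: "rat \<Rightarrow> 'a::ring_1 \<Rightarrow> 'a" and V :: "int \<Rightarrow> 'a set" +
  assumes subspace_V: "subspace (V n)"
    and generated: "\<exists>f. Poly_Mapping.keys f \<subseteq> words V \<and> eval_words s f = a"
    and relations: "Poly_Mapping.keys f \<subseteq> words V \<Longrightarrow>
      eval_words s f = 0 \<longleftrightarrow> f \<in> koszul_ideal s V"

definition total_space :: "(rat \<Rightarrow> 'a::ring_1 \<Rightarrow> 'a) \<Rightarrow> (int \<Rightarrow> 'a set) \<Rightarrow> 'a set" where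
  "total_space s V = module.span s (\<Union>n. V n)"

text \<open>For a graded subspace \<open>W\<close> of \<open>V\<close>, the subalgebra \<open>\<Lambda>W\<close> of \<open>\<Lambda>V\<close>.\<close>

definition Lam :: "(rat \<Rightarrow> 'a::ring_1 \<Rightarrow> 'a) \<Rightarrow> (int \<Rightarrow> 'a set) \<Rightarrow> 'a set" where
  "Lam s W = module.span s (word_prod ` words W)"

definition Lam_degree :: "(rat \<Rightarrow> 'a::ring_1 \<Rightarrow> 'a) \<Rightarrow> (int \<Rightarrow> 'a set) \<Rightarrow> int \<Rightarrow> 'a set" where
  "Lam_degree s V n = module.span s (word_prod ` {w \<in> words V. word_degree w = n})"

definition Lam_length :: "(rat \<Rightarrow> 'a::ring_1 \<Rightarrow> 'a) \<Rightarrow> (int \<Rightarrow> 'a set) \<Rightarrow> nat \<Rightarrow> 'a set" where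
  "Lam_length s V l = module.span s (word_prod ` {w \<in> words V. length w = l})"

text \<open>The component of wordlength \<open>l\<close> with respect to \<open>\<Lambda>V = \<Oplus>\<^sub>l \<Lambda>\<^sup>l V\<close>.\<close>

definition length_component ::
    "(rat \<Rightarrow> 'a::ring_1 \<Rightarrow> 'a) \<Rightarrow> (int \<Rightarrow> 'a set) \<Rightarrow> nat \<Rightarrow> 'a \<Rightarrow> 'a" where
  "length_component s V l a =
    (THE b. b \<in> Lam_length s V l \<and>
            a - b \<in> module.span s (\<Union>j\<in>{j. j \<noteq> l}. Lam_length s V j))"

section \<open>Derivations\<close>

definition Der :: "(rat \<Rightarrow> 'a::ring_1 \<Rightarrow> 'a) \<Rightarrow> (int \<Rightarrow> 'a set) \<Rightarrow> int \<Rightarrow> ('a \<Rightarrow> 'a) set" where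
  "Der s V k = {\<theta>. Vector_Spaces.linear s s \<theta> \<and>
     (\<forall>n. \<forall>x\<in>Lam_degree s V n. \<theta> x \<in> Lam_degree s V (n - k)) \<and>
     (\<forall>n. \<forall>x\<in>Lam_degree s V n. \<forall>y. \<theta> (x * y) = \<theta> x * y + koszul_sign k n * x * \<theta> y)}"

definition bracket :: "int \<Rightarrow> int \<Rightarrow> ('a::ring_1 \<Rightarrow> 'a) \<Rightarrow> ('a \<Rightarrow> 'a) \<Rightarrow> 'a \<Rightarrow> 'a" where
  "bracket p q \<theta> \<eta> = (\<lambda>x. \<theta> (\<eta> x) - koszul_sign p q * \<eta> (\<theta> x))"

text \<open>The differential \<open>d\<close> raises degrees by one, hence has degree \<open>-1\<close> as a derivation.\<close>

definition D :: "('a::ring_1 \<Rightarrow> 'a) \<Rightarrow> int \<Rightarrow> ('a \<Rightarrow> 'a) \<Rightarrow> 'a \<Rightarrow> 'a" where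
  "D d k \<theta> = bracket (-1) k d \<theta>"

definition Der' ::
    "(rat \<Rightarrow> 'a::ring_1 \<Rightarrow> 'a) \<Rightarrow> (int \<Rightarrow> 'a set) \<Rightarrow> ('a \<Rightarrow> 'a) \<Rightarrow> int \<Rightarrow> ('a \<Rightarrow> 'a) set" where
  "Der' s V d k =
    (if k > 1 then Der s V k
     else if k = 1 then {\<theta> \<in> Der s V 1. D d 1 \<theta> = (\<lambda>_. 0)}
     else {\<lambda>_. 0})"

text \<open>
  \<open>L\<^sub>l(\<theta>) \<in> Hom(V, \<Lambda>\<^sup>l\<^sup>+\<^sup>1 V)\<close> for \<open>l \<ge> -1\<close>, as a function on \<open>V = \<Oplus>\<^sub>n V n\<close> extended by zero to the
  rest of the type. For \<open>l = -1\<close> its values lie in \<open>\<Lambda>\<^sup>0 V\<close>, the line of scalars.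
\<close>

definition L ::
    "(rat \<Rightarrow> 'a::ring_1 \<Rightarrow> 'a) \<Rightarrow> (int \<Rightarrow> 'a set) \<Rightarrow> int \<Rightarrow> ('a \<Rightarrow> 'a) \<Rightarrow> 'a \<Rightarrow> 'a" where
  "L s V l \<theta> = (\<lambda>v. if v \<in> total_space s V
                    then length_component s V (nat (l + 1)) (\<theta> v) else 0)"

definition lin_indep_pair ::
    "(rat \<Rightarrow> 'a::ring_1 \<Rightarrow> 'a) \<Rightarrow> ('a \<Rightarrow> 'a) \<Rightarrow> ('a \<Rightarrow> 'a) \<Rightarrow> bool" where
  "lin_indep_pair s f g \<longleftrightarrow>
    (\<forall>a b. (\<lambda>v. s a (f v) + s b (g v)) = (\<lambda>_. 0) \<longrightarrow> a = 0 \<and> b = 0)"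

definition condition_G ::
    "(rat \<Rightarrow> 'a::ring_1 \<Rightarrow> 'a) \<Rightarrow> (int \<Rightarrow> 'a set) \<Rightarrow> ('a \<Rightarrow> 'a) \<Rightarrow> int \<Rightarrow> bool" where
  "condition_G s V d k \<longleftrightarrow>
    (\<forall>\<theta>\<in>Der' s V d k. D d k \<theta> = (\<lambda>_. 0) \<and> L s V (-1) \<theta> = (\<lambda>_. 0) \<longrightarrow>
      (\<exists>\<eta>\<in>Der' s V d (k + 1). D d (k + 1) \<eta> = \<theta>))"

section \<open>Sullivan minimal algebras\<close>

text \<open>
  \<open>F 0 \<subseteq> F 1 \<subseteq> \<dots>\<close> is an exhaustive filtration of \<open>V\<close> by graded subspaces, \<open>F k n\<close> being the part
  of degree \<open>n\<close> of \<open>F k\<close>, with \<open>d = 0\<close> on \<open>F 0\<close> and \<open>d (F (k+1)) \<subseteq> \<Lambda>(F k)\<close>. Minimality says that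
  \<open>d\<close> is decomposable.
\<close>

locale sullivan_minimal_algebra = free_graded_commutative s V
  for s :: "rat \<Rightarrow> 'a::ring_1 \<Rightarrow> 'a" and V :: "int \<Rightarrow> 'a set" +
  fixes d :: "'a \<Rightarrow> 'a"
  assumes positive: "n < 1 \<Longrightarrow> V n = {0}"
    and d_derivation: "d \<in> Der s V (-1)"
    and d_squared: "d (d x) = 0"
    and nilpotence: "\<exists>F :: nat \<Rightarrow> int \<Rightarrow> 'a set.
        (\<forall>k n. subspace (F k n) \<and> F k n \<subseteq> F (Suc k) n) \<and>
        (\<forall>n. (\<Union>k. F k n) = V n) \<and>
        (\<forall>n. \<forall>x\<in>F 0 n. d x = 0) \<and>
        (\<forall>k n. \<forall>x\<in>F (Suc k) n. d x \<in> Lam s (F k))"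
    and decomposable: "x \<in> V n \<Longrightarrow> d x \<in> span (\<Union>l\<in>{2..}. Lam_length s V l)"

definition finite_type :: "(rat \<Rightarrow> 'a::ring_1 \<Rightarrow> 'a) \<Rightarrow> (int \<Rightarrow> 'a set) \<Rightarrow> bool" where
  "finite_type s V \<longleftrightarrow> (\<forall>n. \<exists>B. finite B \<and> B \<subseteq> V n \<and> V n = module.span s B)"

end

theory Submission
  imports Defs
begin

text \<open>
  By symmetry let \<open>p \<le> q\<close>, and let \<open>n\<close> be the least degree with \<open>V\<^sup>n \<noteq> 0\<close>. Choose \<open>v \<in> V\<^sup>p\<close> with
  \<open>\<theta>\<^sub>1 v = 1\<close>. If the conclusion fails, \<open>L\<^sub>-\<^sub>1 \<theta>\<^sub>2\<close> is a multiple of \<open>L\<^sub>-\<^sub>1 \<theta>\<^sub>1\<close>, because boundaries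
  have vanishing \<open>L\<^sub>-\<^sub>1\<close>:

  If \<open>n = p < q\<close>, then \<open>v \<theta>\<^sub>2\<close> is a cycle, hence equal to \<open>D \<omega>\<close> for some \<open>\<omega>\<close>, and
  \<open>D [\<theta>\<^sub>1, \<omega>] = \<plusminus> [\<theta>\<^sub>1, v \<theta>\<^sub>2]\<close> has \<open>L\<^sub>-\<^sub>1\<close> equal to \<open>\<plusminus> L\<^sub>-\<^sub>1 \<theta>\<^sub>2\<close>.

  If \<open>n < p\<close>, let \<open>0 \<noteq> x \<in> V\<^sup>n\<close> and \<open>\<chi>\<close> a functional on \<open>V\<^sup>n\<close> with \<open>\<chi> x = 1\<close>. Then \<open>x \<theta>\<^sub>1 = D \<eta>\<close>. The
  conditions on \<open>\<theta>\<^sub>2\<close> allow the map \<open>y \<mapsto> \<chi>(y) \<theta>\<^sub>2\<close> on \<open>V\<^sup>n\<close> to be extended, degree by degree, to a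
  derivation \<open>G\<close> from \<open>\<Lambda>(V\<^sup>\<le>\<^sup>p)\<close> to the derivations, commuting with the differentials up to sign:
  on decomposable elements \<open>G\<close> takes values with vanishing \<open>L\<^sub>-\<^sub>1\<close>, so each obstruction is a cycle
  covered by \<open>G\<^sub>k\<close>. In Lie algebra terms, \<open>L\<^sub>-\<^sub>1 \<eta>\<close> moves the coadjoint vector \<open>v\<close> to
  \<open>x\<close>, and \<open>G\<close> is a morphism from the coadjoint to the adjoint representation with \<open>G x = \<theta>\<^sub>2\<close>.
  Thus \<open>D [\<eta>, G v]\<close> has \<open>L\<^sub>-\<^sub>1\<close> equal to \<open>\<plusminus> L\<^sub>-\<^sub>1 \<theta>\<^sub>2 \<plusminus> G v x \<cdot> L\<^sub>-\<^sub>1 \<theta>\<^sub>1\<close>.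
\<close>

section \<open>Signs and words\<close>

lemma koszul_sign_zero [simp]: "koszul_sign 0 n = 1" "koszul_sign m 0 = 1"
  by (simp_all add: koszul_sign_def)

lemma words_Nil [simp]: "[] \<in> words V"
  by (simp add: words_def)

lemma words_Cons [simp]: "l # w \<in> words V \<longleftrightarrow> snd l \<in> V (fst l) \<and> w \<in> words V"
  by (auto simp: words_def split: prod.splits)

lemma words_append [simp]: "u @ w \<in> words V \<longleftrightarrow> u \<in> words V \<and> w \<in> words V"
  by (auto simp: words_def)

lemma word_degree_simps [simp]:
  "word_degree [] = 0"
  "word_degree (l # w) = fst l + word_degree w"
  "word_degree (u @ w) = word_degree u + word_degree w"
  by (simp_all add: word_degree_def)

lemma word_prod_simps [simp]:
  "word_prod [] = 1"
  "word_prod (l # w) = snd l * word_prod w"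
  "word_prod (u @ w) = word_prod u * word_prod w"
  by (simp_all add: word_prod_def)

lemma word_prod_zero: "(n, 0) \<in> set w \<Longrightarrow> word_prod w = 0"
  by (induction w) auto

section \<open>Maps out of the free algebra\<close>

text \<open>The target is left open because this serves both \<open>eval_words\<close> and the
  functional \<open>aug\<close>, whose values are rationals.\<close>

definition word_sum ::
    "(rat \<Rightarrow> 'b::ab_group_add \<Rightarrow> 'b) \<Rightarrow> ('w \<Rightarrow> 'b) \<Rightarrow> ('w \<Rightarrow>\<^sub>0 rat) \<Rightarrow> 'b" where
  "word_sum sc T f = (\<Sum>w\<in>Poly_Mapping.keys f. sc (Poly_Mapping.lookup f w) (T w))"

lemma eval_words_eq_word_sum: "eval_words s = word_sum s word_prod"
  by (rule ext) (simp add: eval_words_def word_sum_def)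

context
  fixes sc :: "rat \<Rightarrow> 'b::ab_group_add \<Rightarrow> 'b"
  assumes vs: "vector_space sc"
begin

interpretation vector_space sc by (rule vs)

lemma word_sum_superset:
  assumes "finite A" "Poly_Mapping.keys f \<subseteq> A"
  shows "word_sum sc T f = (\<Sum>w\<in>A. sc (Poly_Mapping.lookup f w) (T w))"
  unfolding word_sum_def
  by (rule sum.mono_neutral_left) (use assms in \<open>auto simp: in_keys_iff\<close>)

lemma word_sum_add: "word_sum sc T (f + g) = word_sum sc T f + word_sum sc T g"
proof -
  let ?A = "Poly_Mapping.keys f \<union> Poly_Mapping.keys g"
  have "Poly_Mapping.keys (f + g) \<subseteq> ?A"
    by (rule Poly_Mapping.keys_add)
  then show ?thesis
    by (simp add: word_sum_superset[of ?A] lookup_add scale_left_distrib sum.distrib)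
qed

lemma word_sum_zero [simp]: "word_sum sc T 0 = 0"
  by (simp add: word_sum_def)

lemma word_sum_diff: "word_sum sc T (f - g) = word_sum sc T f - word_sum sc T g"
  using word_sum_add[of T "f - g" g] by (simp add: algebra_simps)

lemma word_sum_single: "word_sum sc T (Poly_Mapping.single w c) = sc c (T w)"
  by (simp add: word_sum_superset[of "{w}"])

lemma word_sum_scale:
  "word_sum sc T (Poly_Mapping.map ((*) c) f) = sc c (word_sum sc T f)"
proof -
  have "Poly_Mapping.keys (Poly_Mapping.map ((*) c) f) \<subseteq> Poly_Mapping.keys f"
    by (auto simp: in_keys_iff Poly_Mapping.map.rep_eq when_def)
  then show ?thesis
    by (auto simp: word_sum_superset[of "Poly_Mapping.keys f"] Poly_Mapping.map.rep_eq when_def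
        in_keys_iff scale_sum_right intro!: sum.cong)
qed

end

lemma keys_map_scale: "Poly_Mapping.keys (Poly_Mapping.map ((*) c) f) \<subseteq> Poly_Mapping.keys f"
  for c :: rat
  by (auto simp: in_keys_iff Poly_Mapping.map.rep_eq when_def)

context free_graded_commutative
begin

abbreviation word_span :: "((int \<times> 'a) list \<Rightarrow> bool) \<Rightarrow> 'a set" where
  "word_span P \<equiv> span (word_prod ` {w \<in> words V. P w})"

text \<open>Universal property of \<Lambda>V as a quotient: compatibility of \<open>T\<close> with
  the three kinds of relations makes its linear extension vanish on \<open>koszul_ideal\<close>,
  hence on every combination that evaluates to 0.\<close>

lemma word_map_extension:
  fixes sc :: "rat \<Rightarrow> 'b::ab_group_add \<Rightarrow> 'b"
  assumes vs: "vector_space sc"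
    and add: "\<And>u w n x y. u \<in> words V \<Longrightarrow> w \<in> words V \<Longrightarrow> x \<in> V n \<Longrightarrow> y \<in> V n \<Longrightarrow>
      T (u @ [(n, x + y)] @ w) = T (u @ [(n, x)] @ w) + T (u @ [(n, y)] @ w)"
    and scale: "\<And>u w n x r. u \<in> words V \<Longrightarrow> w \<in> words V \<Longrightarrow> x \<in> V n \<Longrightarrow>
      T (u @ [(n, s r x)] @ w) = sc r (T (u @ [(n, x)] @ w))"
    and comm: "\<And>u w m n x y. u \<in> words V \<Longrightarrow> w \<in> words V \<Longrightarrow> x \<in> V m \<Longrightarrow> y \<in> V n \<Longrightarrow>
      T (u @ [(m, x), (n, y)] @ w) = sc (koszul_sign m n) (T (u @ [(n, y), (m, x)] @ w))"
  shows "\<exists>F. Vector_Spaces.linear s sc F \<and> (\<forall>w\<in>words V. F (word_prod w) = T w)"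
proof -
  interpret B: vector_space sc by (rule vs)
  note ws = word_sum_add[OF vs] word_sum_diff[OF vs] word_sum_single[OF vs] word_sum_zero[OF vs]
    word_sum_scale[OF vs]
  note ws' = word_sum_add[OF vector_space_axioms] word_sum_diff[OF vector_space_axioms]
    word_sum_single[OF vector_space_axioms] word_sum_scale[OF vector_space_axioms]
  let ?ok = "\<lambda>f a. Poly_Mapping.keys f \<subseteq> words V \<and> eval_words s f = a"
  \<comment> \<open>An arbitrary combination representing \<open>a\<close> is chosen;
    \<open>ideal\<close> will show that the value does not depend on it.\<close>
  define F where "F a = word_sum sc T (SOME f. ?ok f a)" for a
  have ideal: "word_sum sc T f = 0" if "f \<in> koszul_ideal s V" for f
    using that
  proof induction
    case (rel_add u w x n y c)
    then show ?case by (simp only: ws add) (simp add: B.scale_right_distrib)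
  next
    case (rel_scale u w x n r c)
    then show ?case by (simp only: ws scale) (simp add: B.scale_scale)
  next
    case (rel_comm u w x m y n c)
    then show ?case by (simp only: ws comm[of u w x m y n]) (simp add: B.scale_scale)
  qed (simp_all add: ws)
  have F: "F a = word_sum sc T f" if "?ok f a" for f a
  proof -
    define f' where "f' = (SOME f. ?ok f a)"
    have f': "?ok f' a"
      unfolding f'_def by (rule someI[of "\<lambda>f. ?ok f a"]) (rule that)
    have "eval_words s (f' - f) = 0"
      using that f' by (simp add: eval_words_eq_word_sum ws')
    moreover have "Poly_Mapping.keys (f' - f) \<subseteq> words V"
      using that f' Poly_Mapping.keys_diff[of f' f] by blast
    ultimately have "word_sum sc T (f' - f) = 0"
      using relations ideal by blast
    then show ?thesis
      unfolding F_def f'_def[symmetric] by (simp add: ws)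
  qed
  have "F (a + b) = F a + F b" for a b
  proof -
    obtain f g where "?ok f a" "?ok g b" using generated by meson
    moreover from this have "?ok (f + g) (a + b)"
      using Poly_Mapping.keys_add[of f g] by (auto simp: eval_words_eq_word_sum ws')
    ultimately show ?thesis using F[of f a] F[of g b] F[of "f + g" "a + b"] by (simp add: ws)
  qed
  moreover have "F (s c a) = sc c (F a)" for c a
  proof -
    obtain f where "?ok f a" using generated by meson
    moreover from this have "?ok (Poly_Mapping.map ((*) c) f) (s c a)"
      using keys_map_scale[of c f] by (auto simp: eval_words_eq_word_sum ws')
    ultimately show ?thesis using F[of f a] F[of "Poly_Mapping.map ((*) c) f" "s c a"]
      by (simp add: ws)
  qed
  ultimately have "Vector_Spaces.linear s sc F"
    by unfold_locales
  moreover have "F (word_prod w) = T w" if "w \<in> words V" for w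
    using F[of "Poly_Mapping.single w 1" "word_prod w"] that
    by (simp add: ws ws' eval_words_eq_word_sum)
  ultimately show ?thesis by blast
qed

section \<open>Spans of words and the degree grading\<close>

lemma word_span_True: "a \<in> word_span (\<lambda>_. True)"
proof -
  obtain f where "Poly_Mapping.keys f \<subseteq> words V" "eval_words s f = a"
    using generated by blast
  then have "a = (\<Sum>w\<in>Poly_Mapping.keys f. s (Poly_Mapping.lookup f w) (word_prod w))"
    and "\<And>w. w \<in> Poly_Mapping.keys f \<Longrightarrow> word_prod w \<in> word_span (\<lambda>_. True)"
    by (auto simp: eval_words_def intro: span_base)
  then show ?thesis
    by (auto intro: span_sum span_scale)
qed

lemma word_induct [case_names word zero add scale]:
  assumes "\<And>w. w \<in> words V \<Longrightarrow> P (word_prod w)" "P 0"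
    "\<And>a b. P a \<Longrightarrow> P b \<Longrightarrow> P (a + b)" "\<And>c a. P a \<Longrightarrow> P (s c a)"
  shows "P a"
proof -
  have "a \<in> span (word_prod ` {w \<in> words V. True})" by (rule word_span_True)
  then show ?thesis
    by (induction rule: span_induct_alt) (auto intro: assms)
qed

lemma word_span_induct [consumes 1, case_names word zero add scale]:
  assumes "a \<in> word_span Q"
    "\<And>w. w \<in> words V \<Longrightarrow> Q w \<Longrightarrow> P (word_prod w)" "P 0"
    "\<And>a b. P a \<Longrightarrow> P b \<Longrightarrow> P (a + b)" "\<And>c a. P a \<Longrightarrow> P (s c a)"
  shows "P a"
  using assms(1) by (induction rule: span_induct_alt) (auto intro: assms(2-))

lemma Lam_degree_iff: "a \<in> Lam_degree s V n \<longleftrightarrow> a \<in> word_span (\<lambda>w. word_degree w = n)"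
  by (simp add: Lam_degree_def)

lemma word_in_Lam_degree: "w \<in> words V \<Longrightarrow> word_degree w = n \<Longrightarrow> word_prod w \<in> Lam_degree s V n"
  unfolding Lam_degree_iff by (rule span_base) auto

lemma V_in_Lam_degree: "x \<in> V n \<Longrightarrow> x \<in> Lam_degree s V n"
  using word_in_Lam_degree[of "[(n, x)]" n] by simp

lemma Lam_degree_subspace: "subspace (Lam_degree s V n)"
  by (simp add: Lam_degree_def)

lemma Lam_degree_mult:
  assumes "a \<in> Lam_degree s V m" "b \<in> Lam_degree s V n"
  shows "a * b \<in> Lam_degree s V (m + n)"
proof -
  note sub = subspace_0[OF Lam_degree_subspace] subspace_add[OF Lam_degree_subspace]
    subspace_scale[OF Lam_degree_subspace]
  have 1: "word_prod u * b \<in> Lam_degree s V (m + n)" if "u \<in> words V" "word_degree u = m" for u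
    using assms(2) unfolding Lam_degree_iff[of b]
  proof (induction rule: word_span_induct)
    case (word w)
    then show ?case using that word_in_Lam_degree[of "u @ w" "m + n"] by simp
  qed (auto simp: sub distrib_left scale_mult_right)
  show ?thesis
    using assms(1) unfolding Lam_degree_iff[of a]
    by (induction rule: word_span_induct) (auto simp: 1 sub distrib_right scale_mult_left)
qed

section \<open>Graded commutativity\<close>

lemma scale_koszul_sign: "s (koszul_sign m n) a = koszul_sign m n * a"
  by (simp add: koszul_sign_def)

lemma letters_commute:
  assumes "x \<in> V m" "y \<in> V n"
  shows "x * y = koszul_sign m n * (y * x)"
proof -
  note ws' = word_sum_add[OF vector_space_axioms] word_sum_diff[OF vector_space_axioms]
    word_sum_single[OF vector_space_axioms]
  let ?f = "Poly_Mapping.single ([] @ [(m, x), (n, y)] @ []) 1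
      - Poly_Mapping.single ([] @ [(n, y), (m, x)] @ []) (1 * koszul_sign m n) :: _ \<Rightarrow>\<^sub>0 rat"
  have "?f \<in> koszul_ideal s V"
    by (rule koszul_ideal.rel_comm) (use assms in auto)
  moreover have "Poly_Mapping.keys ?f \<subseteq> words V"
    by (rule subset_trans[OF Poly_Mapping.keys_diff]) (use assms in \<open>auto split: if_splits\<close>)
  ultimately have "eval_words s ?f = 0"
    using relations by blast
  then show ?thesis
    by (simp add: eval_words_eq_word_sum ws' scale_koszul_sign)
qed

lemma letter_word_commute:
  assumes "x \<in> V m" "w \<in> words V"
  shows "x * word_prod w = koszul_sign m (word_degree w) * (word_prod w * x)"
  using assms(2)
proof (induction w)
  case (Cons l w)
  have "x * (snd l * word_prod w) = koszul_sign m (fst l) * (snd l * (x * word_prod w))"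
    using letters_commute[OF assms(1), of "snd l" "fst l"] Cons.prems
    by (simp add: mult.assoc[symmetric])
  also have "\<dots> = koszul_sign m (fst l + word_degree w) * (snd l * word_prod w * x)"
    using Cons by (simp add: koszul_sign_def mult.assoc)
  finally show ?case by simp
qed simp

lemma words_commute:
  assumes "u \<in> words V" "w \<in> words V"
  shows "word_prod u * word_prod w =
    koszul_sign (word_degree u) (word_degree w) * (word_prod w * word_prod u)"
  using assms(1)
proof (induction u)
  case (Cons l u)
  have "snd l * word_prod u * word_prod w =
      koszul_sign (word_degree u) (word_degree w) * (snd l * word_prod w * word_prod u)"
    using Cons by (simp add: koszul_sign_def mult.assoc)
  also have "snd l * word_prod w = koszul_sign (fst l) (word_degree w) * (word_prod w * snd l)"
    using letter_word_commute[of "snd l" "fst l" w] Cons.prems assms(2) by simp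
  finally show ?case by (simp add: koszul_sign_def mult.assoc)
qed simp

lemma graded_commute:
  assumes "a \<in> Lam_degree s V m" "b \<in> Lam_degree s V n"
  shows "a * b = koszul_sign m n * (b * a)"
proof -
  have 1: "word_prod u * b = koszul_sign m n * (b * word_prod u)"
    if "u \<in> words V" "word_degree u = m" for u
    using assms(2) unfolding Lam_degree_iff[of b]
  proof (induction rule: word_span_induct)
    case (word w)
    then show ?case using words_commute[of u w] that by simp
  qed (auto simp: koszul_sign_def distrib_left distrib_right scale_mult_left scale_mult_right)
  show ?thesis
    using assms(1) unfolding Lam_degree_iff[of a]
    by (induction rule: word_span_induct)
      (use 1 in \<open>auto simp: koszul_sign_def distrib_left distrib_right
        scale_mult_left scale_mult_right\<close>)
qed

section \<open>Augmentation and degrees\<close>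

text \<open>The projection of \<Lambda>V onto the scalars that kills all nonempty words. Being
  multiplicative, it is easier to handle than \<open>L s V (-1)\<close>, which it computes.\<close>

definition aug :: "'a \<Rightarrow> rat" where
  "aug = (SOME F. Vector_Spaces.linear s (*) F \<and>
    (\<forall>w\<in>words V. F (word_prod w) = (if w = [] then 1 else 0)))"

lemma aug: "Vector_Spaces.linear s (*) aug"
    "w \<in> words V \<Longrightarrow> aug (word_prod w) = (if w = [] then 1 else 0)"
proof -
  have "vector_space ((*) :: rat \<Rightarrow> rat \<Rightarrow> rat)"
    by unfold_locales (auto simp: algebra_simps)
  then have "\<exists>F. Vector_Spaces.linear s ((*) :: rat \<Rightarrow> rat \<Rightarrow> rat) F \<and>
    (\<forall>w\<in>words V. F (word_prod w) = (if w = [] then 1 else 0))"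
    by (rule word_map_extension) auto
  from someI_ex[OF this]
  show "Vector_Spaces.linear s (*) aug"
    "w \<in> words V \<Longrightarrow> aug (word_prod w) = (if w = [] then 1 else 0)"
    by (auto simp: aug_def)
qed

lemma aug_simps [simp]:
  "aug (a + b) = aug a + aug b" "aug (s c a) = c * aug a" "aug 0 = 0"
  "aug (- a) = - aug a" "aug (a - b) = aug a - aug b" "aug 1 = 1"
proof -
  interpret A: Vector_Spaces.linear s "(*)" aug by (rule aug)
  show "aug (a + b) = aug a + aug b" "aug (s c a) = c * aug a" "aug 0 = 0"
    "aug (- a) = - aug a" "aug (a - b) = aug a - aug b"
    by (simp_all add: A.add A.scale A.zero A.neg A.diff)
  show "aug 1 = 1"
    using aug(2)[of "[]"] by simp
qed

lemma aug_mult [simp]: "aug (a * b) = aug a * aug b"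
proof -
  have 1: "aug (word_prod u * b) = aug (word_prod u) * aug b" if "u \<in> words V" for u
  proof (induction b rule: word_induct)
    case (word w)
    then show ?case using that aug(2)[of "u @ w"] aug(2)[of u] aug(2)[of w] by auto
  qed (auto simp: distrib_left scale_mult_right)
  show ?thesis
    by (induction a rule: word_induct) (auto simp: 1 distrib_right scale_mult_left)
qed

lemma aug_koszul_sign [simp]: "aug (koszul_sign m n) = koszul_sign m n"
  by (simp add: koszul_sign_def)

lemma aug_V: "x \<in> V n \<Longrightarrow> aug x = 0"
  using aug(2)[of "[(n, x)]"] by simp

lemma aug_degree:
  assumes "a \<in> Lam_degree s V n" "n \<noteq> 0"
  shows "aug a = 0"
  using assms(1) unfolding Lam_degree_iff
  by (induction rule: word_span_induct) (use assms(2) aug(2) in auto)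

text \<open>\<open>\<Lambda>\<^sup>0 V\<close> is the line through 1, and subtracting
  \<open>s (aug a) 1\<close> leaves words of positive length; uniqueness holds because
  \<open>aug\<close> vanishes on those.\<close>

lemma length_component_0: "length_component s V 0 a = s (aug a) 1"
proof -
  let ?S = "span (\<Union>j\<in>{j. j \<noteq> 0}. Lam_length s V j)"
  have l0: "Lam_length s V 0 = span {1}"
  proof -
    have "{w \<in> words V. length w = 0} = {[]}" by auto
    then show ?thesis by (simp add: Lam_length_def)
  qed
  have ex: "a - s (aug a) 1 \<in> ?S" for a
  proof (induction a rule: word_induct)
    case (word w)
    show ?case
    proof (cases "w = []")
      case False
      then have "word_prod w \<in> Lam_length s V (length w)"
        unfolding Lam_length_def by (intro span_base) (use word in auto)
      then show ?thesis using word False aug(2)[of w] by (auto intro: span_base)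
    qed (auto simp: span_zero)
  next
    case (add a b)
    then show ?case using span_add[OF add] by (simp add: algebra_simps scale_left_distrib)
  next
    case (scale c a)
    then show ?case using span_scale[OF scale, of c] by (simp add: scale_right_diff_distrib)
  qed (auto simp: span_zero)
  have augS: "aug b = 0" if "b \<in> ?S" for b
    using that
  proof (induction rule: span_induct_alt)
    case (step c x y)
    then obtain j where j: "j \<noteq> 0" "x \<in> word_span (\<lambda>w. length w = j)"
      by (auto simp: Lam_length_def)
    from j(2) have "aug x = 0"
      by (induction rule: word_span_induct) (use aug(2) j(1) in auto)
    then show ?case using step by simp
  qed auto
  show ?thesis
    unfolding length_component_def
  proof (rule the_equality)
    show "s (aug a) 1 \<in> Lam_length s V 0 \<and> a - s (aug a) 1 \<in> ?S"
      using ex by (simp add: l0 span_base span_scale)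
    fix b assume b: "b \<in> Lam_length s V 0 \<and> a - b \<in> ?S"
    then obtain c where c: "b = s c 1" by (auto simp: l0 span_singleton)
    with b augS[of "a - b"] show "b = s (aug a) 1" by simp
  qed
qed

text \<open>Swapping letters preserves degree, so there is a projection \<open>F\<close> onto degree
  \<open>n\<close> that keeps or kills each word. It fixes \<open>a\<close> and discards the words
  of other degrees from any expression of \<open>a\<close>.\<close>

lemma word_span_degree:
  assumes "a \<in> word_span P" "a \<in> Lam_degree s V n"
  shows "a \<in> word_span (\<lambda>w. P w \<and> word_degree w = n)"
proof -
  have comm: "a * (x * (y * b)) = s (koszul_sign i j) (a * (y * (x * b)))"
    if "x \<in> V i" "y \<in> V j" for a b x y i j
    using arg_cong[OF letters_commute[OF that], of "\<lambda>z. a * (z * b)"]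
    by (simp add: koszul_sign_def mult.assoc)
  have "\<exists>F. Vector_Spaces.linear s s F \<and>
      (\<forall>w\<in>words V. F (word_prod w) = (if word_degree w = n then word_prod w else 0))"
  proof (rule word_map_extension, goal_cases)
    case (4 u w i j x y)
    then show ?case by (simp add: comm[of x i y j] add.left_commute)
  qed (simp_all add: vector_space_axioms distrib_left distrib_right scale_mult_left scale_mult_right)
  then obtain F where "Vector_Spaces.linear s s F" and
    F: "\<And>w. w \<in> words V \<Longrightarrow> F (word_prod w) = (if word_degree w = n then word_prod w else 0)"
    by blast
  then interpret F: Vector_Spaces.linear s s F by blast
  have "F a = a"
    using assms(2) unfolding Lam_degree_iff
    by (induction rule: word_span_induct) (auto simp: F F.add F.scale)
  moreover have "F a \<in> word_span (\<lambda>w. P w \<and> word_degree w = n)"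
    using assms(1)
  proof (induction rule: word_span_induct)
    case (word w)
    then show ?case by (simp add: F span_zero) (simp add: span_base)
  qed (simp_all add: F.zero F.add F.scale span_zero span_add span_scale)
  ultimately show ?thesis by simp
qed

section \<open>Derivations\<close>

lemma linear_koszul_sign:
  assumes "Vector_Spaces.linear s s f"
  shows "f (koszul_sign m n * x) = koszul_sign m n * f x"
proof -
  interpret f: Vector_Spaces.linear s s f by (rule assms)
  show ?thesis by (simp add: koszul_sign_def f.neg)
qed

lemma DerD:
  assumes "\<theta> \<in> Der s V k"
  shows Der_linear: "Vector_Spaces.linear s s \<theta>"
    and Der_degree: "x \<in> Lam_degree s V n \<Longrightarrow> \<theta> x \<in> Lam_degree s V (n - k)"
    and Der_mult: "x \<in> Lam_degree s V n \<Longrightarrow> \<theta> (x * y) = \<theta> x * y + koszul_sign k n * x * \<theta> y"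
  using assms by (auto simp: Der_def)

lemma Der_simps:
  assumes "\<theta> \<in> Der s V k"
  shows "\<theta> (a + b) = \<theta> a + \<theta> b" "\<theta> (a - b) = \<theta> a - \<theta> b" "\<theta> (s c a) = s c (\<theta> a)" "\<theta> 0 = 0"
    "\<theta> (- a) = - \<theta> a" "\<theta> (koszul_sign m n * a) = koszul_sign m n * \<theta> a"
proof -
  interpret f: Vector_Spaces.linear s s \<theta> by (rule Der_linear[OF assms])
  show "\<theta> (a + b) = \<theta> a + \<theta> b" "\<theta> (a - b) = \<theta> a - \<theta> b" "\<theta> (s c a) = s c (\<theta> a)" "\<theta> 0 = 0"
    "\<theta> (- a) = - \<theta> a" "\<theta> (koszul_sign m n * a) = koszul_sign m n * \<theta> a"
    by (simp_all add: f.add f.diff f.scale f.zero f.neg linear_koszul_sign[OF Der_linear[OF assms]])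
qed

lemma DerI:
  assumes "\<And>a b. \<theta> (a + b) = \<theta> a + \<theta> b" "\<And>c a. \<theta> (s c a) = s c (\<theta> a)"
    "\<And>n x. x \<in> Lam_degree s V n \<Longrightarrow> \<theta> x \<in> Lam_degree s V (n - k)"
    "\<And>n x y. x \<in> Lam_degree s V n \<Longrightarrow> \<theta> (x * y) = \<theta> x * y + koszul_sign k n * x * \<theta> y"
  shows "\<theta> \<in> Der s V k"
proof -
  have "Vector_Spaces.linear s s \<theta>"
    by unfold_locales (auto simp: assms)
  then show ?thesis using assms by (auto simp: Der_def)
qed

lemmas Lam_degree_closed = subspace_0[OF Lam_degree_subspace] subspace_add[OF Lam_degree_subspace]
  subspace_scale[OF Lam_degree_subspace] subspace_neg[OF Lam_degree_subspace]
  subspace_diff[OF Lam_degree_subspace]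

lemma Lam_degree_koszul_sign:
  "x \<in> Lam_degree s V n \<Longrightarrow> koszul_sign i j * x \<in> Lam_degree s V n"
  by (simp add: koszul_sign_def Lam_degree_closed)

lemma one_in_Lam_degree: "1 \<in> Lam_degree s V 0"
  using word_in_Lam_degree[of "[]" 0] by simp

lemma Der_one: "\<theta> \<in> Der s V k \<Longrightarrow> \<theta> 1 = 0"
  using Der_mult[of \<theta> k 1 0 1] one_in_Lam_degree by simp

lemma Der_zero: "(\<lambda>_. 0) \<in> Der s V k"
  by (rule DerI) (auto simp: Lam_degree_closed)

lemma Der_add: "\<theta> \<in> Der s V k \<Longrightarrow> \<eta> \<in> Der s V k \<Longrightarrow> (\<lambda>x. \<theta> x + \<eta> x) \<in> Der s V k"
  by (rule DerI)
    (auto simp: Der_simps Der_mult Lam_degree_closed Der_degree scale_right_distrib algebra_simps)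

lemma Der_scale: "\<theta> \<in> Der s V k \<Longrightarrow> (\<lambda>x. s c (\<theta> x)) \<in> Der s V k"
  by (rule DerI)
    (auto simp: Der_simps Der_mult Lam_degree_closed Der_degree scale_right_distrib
      scale_mult_left scale_mult_right scale_left_commute)

lemma Der_koszul_sign: "\<theta> \<in> Der s V k \<Longrightarrow> (\<lambda>x. koszul_sign m n * \<theta> x) \<in> Der s V k"
  using Der_scale[of \<theta> k "koszul_sign m n"] by (simp add: scale_koszul_sign)

text \<open>Derivations form a left \<Lambda>V-module: moving \<open>a\<close> past \<open>x\<close>
  turns the sign for \<open>k\<close> into the sign for \<open>k - i\<close>.\<close>

lemma Der_smult:
  assumes "a \<in> Lam_degree s V i" "\<theta> \<in> Der s V k"
  shows "(\<lambda>b. a * \<theta> b) \<in> Der s V (k - i)"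
proof (rule DerI)
  fix n x y assume x: "x \<in> Lam_degree s V n"
  show "a * \<theta> x \<in> Lam_degree s V (n - (k - i))"
    using Lam_degree_mult[OF assms(1) Der_degree[OF assms(2) x]] by (simp add: algebra_simps)
  have "a * x = koszul_sign i n * (x * a)"
    by (rule graded_commute[OF assms(1) x])
  from arg_cong[OF this, of "\<lambda>z. z * \<theta> y"]
  show "a * \<theta> (x * y) = a * \<theta> x * y + koszul_sign (k - i) n * x * (a * \<theta> y)"
    by (auto simp: Der_mult[OF assms(2) x] koszul_sign_def distrib_left mult.assoc)
qed (auto simp: Der_simps[OF assms(2)] distrib_left scale_mult_right)

lemma Der_bracket:
  assumes \<theta>: "\<theta> \<in> Der s V p" and \<eta>: "\<eta> \<in> Der s V q"
  shows "bracket p q \<theta> \<eta> \<in> Der s V (p + q)"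
proof (rule DerI)
  fix n x y assume x: "x \<in> Lam_degree s V n"
  have 1: "\<theta> (\<eta> x) \<in> Lam_degree s V (n - (p + q))" "\<eta> (\<theta> x) \<in> Lam_degree s V (n - (p + q))"
    using Der_degree[OF \<theta> Der_degree[OF \<eta> x]] Der_degree[OF \<eta> Der_degree[OF \<theta> x]]
    by (simp_all add: algebra_simps)
  then show "bracket p q \<theta> \<eta> x \<in> Lam_degree s V (n - (p + q))"
    by (simp add: bracket_def Lam_degree_closed Lam_degree_koszul_sign)
  note x' = Der_degree[OF \<theta> x] Der_degree[OF \<eta> x]
  show "bracket p q \<theta> \<eta> (x * y) =
      bracket p q \<theta> \<eta> x * y + koszul_sign (p + q) n * x * bracket p q \<theta> \<eta> y"
    unfolding bracket_def Der_mult[OF \<theta> x] Der_mult[OF \<eta> x] Der_simps[OF \<theta>] Der_simps[OF \<eta>]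
      mult.assoc Der_mult[OF \<theta> x'(2)] Der_mult[OF \<eta> x'(1)] Der_mult[OF \<theta> x] Der_mult[OF \<eta> x]
    by (cases "even p"; cases "even q"; cases "even n")
      (simp_all add: koszul_sign_def algebra_simps)
qed (auto simp: bracket_def Der_simps[OF \<theta>] Der_simps[OF \<eta>] algebra_simps scale_mult_right
  scale_right_diff_distrib)

lemma aug_decomposable: "a \<in> word_span (\<lambda>w. 2 \<le> length w) \<Longrightarrow> aug a = 0"
  by (induction rule: word_span_induct) (auto simp: aug(2))

text \<open>A derivation shortens a word by at most one letter: on a product of two factors killed
  by \<open>aug\<close>, each Leibniz term keeps one of them.\<close>

lemma aug_Der_decomposable:
  assumes \<theta>: "\<theta> \<in> Der s V k" and "a \<in> word_span (\<lambda>w. 2 \<le> length w)"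
  shows "aug (\<theta> a) = 0"
  using assms(2)
proof (induction rule: word_span_induct)
  case (word w)
  then obtain l u where w: "w = l # u" and u: "u \<noteq> []"
    by (cases w) (auto simp: Suc_le_eq)
  have l: "snd l \<in> V (fst l)" "u \<in> words V" using word w by auto
  from u l show ?case
    by (simp add: w Der_mult[OF \<theta> V_in_Lam_degree[OF l(1)]] aug_V[OF l(1)] aug(2) mult.assoc)
qed (auto simp: Der_simps[OF \<theta>])

section \<open>Biderivations\<close>

text \<open>
  A biderivation of degree \<open>N\<close> is the derivation \<open>a \<mapsto> G a\<close> of degree \<open>-N\<close> from \<open>\<Lambda>V\<close> to the
  \<open>\<Lambda>V\<close>-bimodule of derivations, whose right action is
  \<open>\<psi> a = (-1)\<^bsup>|\<psi>||a|\<^esup> a \<psi>\<close>; it is a map out of the module of Kaehler differentials.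
\<close>

definition bider :: "int \<Rightarrow> ('a \<Rightarrow> 'a \<Rightarrow> 'a) \<Rightarrow> bool" where
  "bider N G \<longleftrightarrow> (\<forall>b. Vector_Spaces.linear s s (\<lambda>a. G a b)) \<and>
    (\<forall>i j. \<forall>a\<in>Lam_degree s V i. \<forall>a'\<in>Lam_degree s V j. \<forall>b.
      G (a * a') b = koszul_sign (N - i) j * a' * G a b + koszul_sign N i * a * G a' b)"

lemma bider_mult:
  "bider N G \<Longrightarrow> a \<in> Lam_degree s V i \<Longrightarrow> a' \<in> Lam_degree s V j \<Longrightarrow>
    G (a * a') b = koszul_sign (N - i) j * a' * G a b + koszul_sign N i * a * G a' b"
  unfolding bider_def by blast

lemma bider_linear: "bider N G \<Longrightarrow> Vector_Spaces.linear s s (\<lambda>a. G a b)"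
  unfolding bider_def by blast

lemma bider_simps:
  assumes "bider N G"
  shows "G (a + a') b = G a b + G a' b" "G (a - a') b = G a b - G a' b" "G (s c a) b = s c (G a b)"
    "G 0 b = 0" "G (- a) b = - G a b" "G (koszul_sign m n * a) b = koszul_sign m n * G a b"
    "G 1 b = 0"
proof -
  interpret f: Vector_Spaces.linear s s "\<lambda>a. G a b" by (rule bider_linear[OF assms])
  show "G (a + a') b = G a b + G a' b" "G (a - a') b = G a b - G a' b" "G (s c a) b = s c (G a b)"
    "G 0 b = 0" "G (- a) b = - G a b" "G (koszul_sign m n * a) b = koszul_sign m n * G a b"
    by (simp_all add: f.add f.diff f.scale f.zero f.neg
        linear_koszul_sign[OF bider_linear[OF assms, of b]])
  show "G 1 b = 0"
    using bider_mult[OF assms one_in_Lam_degree one_in_Lam_degree, of b] by simp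
qed

text \<open>The value that the rule in \<open>bider\<close> forces on a word once the values
  \<open>g\<close> on letters are given.\<close>

fun bider_word :: "int \<Rightarrow> (int \<Rightarrow> 'a \<Rightarrow> 'a) \<Rightarrow> (int \<times> 'a) list \<Rightarrow> 'a" where
  "bider_word N g [] = 0"
| "bider_word N g (l # w) = koszul_sign (N - fst l) (word_degree w) * word_prod w * g (fst l) (snd l)
    + koszul_sign N (fst l) * snd l * bider_word N g w"

text \<open>Splitting a word anywhere reduces compatibility with a relation inside a word to the one
  or two letters concerned.\<close>

lemma bider_word_append:
  assumes "u \<in> words V" "w \<in> words V"
  shows "bider_word N g (u @ w) =
    koszul_sign (N - word_degree u) (word_degree w) * word_prod w * bider_word N g u +
    koszul_sign N (word_degree u) * word_prod u * bider_word N g w"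
  using assms(1)
proof (induction u)
  case (Cons l u)
  have c1: "word_prod u * (word_prod w * z) =
      koszul_sign (word_degree u) (word_degree w) * (word_prod w * (word_prod u * z))" for z
    using arg_cong[OF words_commute[of u w], of "\<lambda>y. y * z"] Cons.prems assms(2)
    by (simp add: mult.assoc)
  have c2: "snd l * (word_prod w * z) =
      koszul_sign (fst l) (word_degree w) * (word_prod w * (snd l * z))" for z
    using arg_cong[OF letter_word_commute[of "snd l" "fst l" w], of "\<lambda>y. y * z"]
      Cons.prems assms(2) by (simp add: mult.assoc)
  let ?g = "g (fst l) (snd l)" and ?n = "fst l" and ?u = "word_degree u" and ?w = "word_degree w"
  have IH: "bider_word N g (u @ w) =
    koszul_sign (N - ?u) ?w * word_prod w * bider_word N g u +
    koszul_sign N ?u * word_prod u * bider_word N g w"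
    using Cons by simp
  show ?case
    by (cases "even N"; cases "even ?n"; cases "even ?u"; cases "even ?w")
      (simp_all add: IH koszul_sign_def algebra_simps c1[of ?g]
        c2[of "bider_word N g u"])
qed simp

text \<open>Freeness: values on generators may be prescribed. The rule in \<open>bider\<close>
  leaves the second argument alone, so each \<open>b\<close> is treated separately.\<close>

lemma bider_extension:
  assumes g: "\<And>j b. Vector_Spaces.linear s s (\<lambda>x. g j x b)"
  obtains G where "bider N G" "\<And>j x b. x \<in> V j \<Longrightarrow> G x b = g j x b"
proof -
  let ?T = "\<lambda>b. bider_word N (\<lambda>j x. g j x b)"
  have "\<exists>F. Vector_Spaces.linear s s F \<and> (\<forall>w\<in>words V. F (word_prod w) = ?T b w)" for b
  proof (rule word_map_extension, goal_cases)
    case 1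
    show ?case by (rule vector_space_axioms)
  next
    case (2 u w n x y)
    interpret f: Vector_Spaces.linear s s "\<lambda>x. g n x b" by (rule g)
    have xy: "x + y \<in> V n" using 2 subspace_V subspace_add by blast
    show ?case
      using 2 xy by (simp add: bider_word_append f.add distrib_left distrib_right mult.assoc)
  next
    case (3 u w n x r)
    interpret f: Vector_Spaces.linear s s "\<lambda>x. g n x b" by (rule g)
    have rx: "s r x \<in> V n" using 3 subspace_V subspace_scale by blast
    show ?case
      using 3 rx by (simp add: bider_word_append f.scale scale_mult_left scale_mult_right
          scale_right_distrib distrib_left distrib_right mult.assoc)
  next
    case (4 u w m n x y)
    have c: "x * (y * z) = koszul_sign m n * (y * (x * z))" for z
      using arg_cong[OF letters_commute[OF 4(3,4)], of "\<lambda>y. y * z"] by (simp add: mult.assoc)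
    \<comment> \<open>The twisted right action makes the rule symmetric in the two letters up to the
      Koszul sign.\<close>
    have xy: "?T b [(m, x), (n, y)] = koszul_sign m n * ?T b [(n, y), (m, x)]"
      by (cases "even N"; cases "even m"; cases "even n") (simp_all add: koszul_sign_def)
    have e1: "?T b ([(m, x), (n, y)] @ w) = koszul_sign (N - (m + n)) (word_degree w) * word_prod w *
        ?T b [(m, x), (n, y)] + koszul_sign N (m + n) * (x * y) * ?T b w"
      using 4 by (subst bider_word_append) auto
    have e2: "?T b ([(n, y), (m, x)] @ w) = koszul_sign (N - (m + n)) (word_degree w) * word_prod w *
        ?T b [(n, y), (m, x)] + koszul_sign N (m + n) * (y * x) * ?T b w"
      using 4 by (subst bider_word_append) (auto simp: add.commute)
    have "?T b ([(m, x), (n, y)] @ w) = koszul_sign m n * ?T b ([(n, y), (m, x)] @ w)"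
      unfolding e1 e2 xy by (simp add: koszul_sign_def distrib_left mult.assoc c[of "?T b w"])
    moreover have "word_prod ([(m, x), (n, y)] @ w) =
        koszul_sign m n * word_prod ([(n, y), (m, x)] @ w)"
      using c[of "word_prod w"] by simp
    moreover have "word_degree ([(m, x), (n, y)] @ w) = word_degree ([(n, y), (m, x)] @ w)"
      by simp
    moreover have "[(m, x), (n, y)] @ w \<in> words V" "[(n, y), (m, x)] @ w \<in> words V"
      using 4 by auto
    ultimately show ?case
      using 4(1) by (simp only: bider_word_append scale_koszul_sign)
        (simp add: koszul_sign_def algebra_simps)
  qed
  then obtain F where F: "\<And>b. Vector_Spaces.linear s s (F b)"
    "\<And>b w. w \<in> words V \<Longrightarrow> F b (word_prod w) = ?T b w" by metis
  define G where "G a b = F b a" for a b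
  have G: "Vector_Spaces.linear s s (\<lambda>a. G a b)" for b
    using F(1) by (simp add: G_def)
  have add: "G (a + a') b = G a b + G a' b" and scale: "G (s c a) b = s c (G a b)"
    and zero: "G 0 b = 0" for a a' b c
  proof -
    interpret f: Vector_Spaces.linear s s "\<lambda>a. G a b" by (rule G)
    show "G (a + a') b = G a b + G a' b" "G (s c a) b = s c (G a b)" "G 0 b = 0"
      by (simp_all add: f.add f.scale f.zero)
  qed
  have w: "G (word_prod u * a') b =
      koszul_sign (N - i) j * a' * G (word_prod u) b + koszul_sign N i * word_prod u * G a' b"
    if "u \<in> words V" "word_degree u = i" "a' \<in> Lam_degree s V j" for u a' i j b
    using that(3) unfolding Lam_degree_iff
  proof (induction rule: word_span_induct)
    case (word w)
    then show ?case using F(2)[of "u @ w"] F(2)[of u] F(2)[of w] that(1,2)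
      by (simp add: G_def bider_word_append)
  qed (auto simp: zero add scale algebra_simps scale_mult_left scale_mult_right scale_right_distrib)
  have "G (a * a') b = koszul_sign (N - i) j * a' * G a b + koszul_sign N i * a * G a' b"
    if "a \<in> Lam_degree s V i" "a' \<in> Lam_degree s V j" for a a' i j b
    using that(1) unfolding Lam_degree_iff
    by (induction rule: word_span_induct)
      (auto simp: w[OF _ _ that(2)] zero add scale algebra_simps scale_mult_left scale_mult_right
        scale_right_distrib)
  with G have "bider N G"
    unfolding bider_def by blast
  moreover have "G x b = g j x b" if "x \<in> V j" for j x b
    using F(2)[of "[(j, x)]" b] that by (simp add: G_def)
  ultimately show ?thesis by (rule that)
qed

lemma bider_agree:
  assumes G: "bider N G" "bider N G'" and "\<And>l. l \<in> set w \<Longrightarrow> G (snd l) b = G' (snd l) b"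
    and "w \<in> words V"
  shows "G (word_prod w) b = G' (word_prod w) b"
  using assms(3,4)
proof (induction w)
  case (Cons l w)
  then have "snd l \<in> Lam_degree s V (fst l)" "word_prod w \<in> Lam_degree s V (word_degree w)"
    by (auto intro: V_in_Lam_degree word_in_Lam_degree)
  from bider_mult[OF G(1) this] bider_mult[OF G(2) this] Cons show ?case by simp
qed (simp add: bider_simps[OF G(1)] bider_simps[OF G(2)])

text \<open>By \<open>Der_smult\<close> derivations are closed under multiplication by \<Lambda>V,
  so the generators decide.\<close>

lemma bider_in_Der:
  assumes G: "bider N G" and V: "\<And>j x. x \<in> V j \<Longrightarrow> G x \<in> Der s V (N - j)"
    and a: "a \<in> Lam_degree s V i"
  shows "G a \<in> Der s V (N - i)"
proof -
  have 1: "G (word_prod w) \<in> Der s V (N - word_degree w)" if "w \<in> words V" for w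
    using that
  proof (induction w)
    case Nil
    have "G 1 = (\<lambda>_. 0)" by (rule ext) (simp add: bider_simps[OF G])
    then show ?case by (simp add: Der_zero)
  next
    case (Cons l w)
    let ?n = "fst l" and ?m = "word_degree w"
    from Cons have l: "snd l \<in> Lam_degree s V ?n" "word_prod w \<in> Lam_degree s V ?m"
      by (auto intro: V_in_Lam_degree word_in_Lam_degree)
    have "G (snd l * word_prod w) = (\<lambda>b. koszul_sign (N - ?n) ?m * (word_prod w * G (snd l) b) +
        koszul_sign N ?n * (snd l * G (word_prod w) b))"
      by (rule ext) (simp add: bider_mult[OF G l] mult.assoc)
    moreover have "(\<lambda>b. word_prod w * G (snd l) b) \<in> Der s V (N - (?n + ?m))"
      using Der_smult[OF l(2) V[of "snd l" ?n]] Cons by (simp add: algebra_simps)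
    moreover have "(\<lambda>b. snd l * G (word_prod w) b) \<in> Der s V (N - (?n + ?m))"
      using Der_smult[OF l(1) Cons.IH] Cons by (simp add: algebra_simps)
    ultimately show ?case
      by (simp add: Der_add Der_koszul_sign)
  qed
  from a show ?thesis
    unfolding Lam_degree_iff
  proof (induction rule: word_span_induct)
    case (word w)
    then show ?case using 1[of w] by simp
  next
    case zero
    have "G 0 = (\<lambda>_. 0)" by (rule ext) (simp add: bider_simps[OF G])
    then show ?case by (simp add: Der_zero)
  next
    case (add a b)
    have "G (a + b) = (\<lambda>x. G a x + G b x)" by (rule ext) (simp add: bider_simps[OF G])
    with add show ?case by (simp add: Der_add)
  next
    case (scale c a)
    have "G (s c a) = (\<lambda>x. s c (G a x))" by (rule ext) (simp add: bider_simps[OF G])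
    with scale show ?case by (simp add: Der_scale)
  qed
qed

text \<open>As for derivations, each term of \<open>G\<close> on a product keeps one factor killed
  by \<open>aug\<close>.\<close>

lemma aug_bider_decomposable:
  assumes G: "bider N G" and "a \<in> word_span (\<lambda>w. 2 \<le> length w)"
  shows "aug (G a b) = 0"
  using assms(2)
proof (induction rule: word_span_induct)
  case (word w)
  then obtain l u where w: "w = l # u" and u: "u \<noteq> []"
    by (cases w) (auto simp: Suc_le_eq)
  have l: "snd l \<in> V (fst l)" "u \<in> words V" using word w by auto
  from u l show ?case
    by (simp add: w bider_mult[OF G V_in_Lam_degree[OF l(1)] word_in_Lam_degree[OF l(2) refl]]
        aug_V[OF l(1)] aug(2) mult.assoc)
qed (auto simp: bider_simps[OF G])

text \<open>
  The difference of the two sides, as a function of \<open>a\<close>, is a derivation into the derivations,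
  up to signs, so it is decomposable on decomposable elements.
\<close>

lemma aug_Der_bider_decomposable:
  assumes \<eta>: "\<eta> \<in> Der s V r" and G: "bider N G" and "a \<in> word_span (\<lambda>w. 2 \<le> length w)"
  shows "aug (\<eta> (G a b)) = koszul_sign N r * aug (G (\<eta> a) b)"
  using assms(3)
proof (induction rule: word_span_induct)
  case (word w)
  then obtain l u where w: "w = l # u" and u: "u \<noteq> []"
    by (cases w) (auto simp: Suc_le_eq)
  have l: "snd l \<in> V (fst l)" "u \<in> words V" using word w by auto
  define x y i j where xy: "x = snd l" "y = word_prod u" "i = fst l" "j = word_degree u"
  have x: "x \<in> Lam_degree s V i" and y: "y \<in> Lam_degree s V j"
    using l by (auto simp: xy intro: V_in_Lam_degree word_in_Lam_degree)
  have a: "aug x = 0" "aug y = 0"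
    using l u by (auto simp: xy aug_V aug(2))
  \<comment> \<open>Only the terms in which \<open>\<eta>\<close> differentiates the outer factor
    \<open>x\<close> or \<open>y\<close> survive, since \<open>aug\<close> kills both.\<close>
  have "aug (\<eta> (G (x * y) b)) = koszul_sign (N - i) j * (aug (\<eta> y) * aug (G x b))
      + koszul_sign N i * (aug (\<eta> x) * aug (G y b))"
    by (simp add: bider_mult[OF G x y] Der_simps[OF \<eta>] mult.assoc Der_mult[OF \<eta> x] Der_mult[OF \<eta> y]
        a)
  moreover have "aug (G (\<eta> (x * y)) b) = koszul_sign N (i - r) * (aug (\<eta> x) * aug (G y b)) +
      koszul_sign r i * (koszul_sign (N - i) (j - r) * (aug (\<eta> y) * aug (G x b)))"
    by (simp add: Der_mult[OF \<eta> x] bider_simps[OF G] mult.assoc a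
        bider_mult[OF G x Der_degree[OF \<eta> y]] bider_mult[OF G Der_degree[OF \<eta> x] y])
  ultimately show ?case
    by (cases "even N"; cases "even r"; cases "even i"; cases "even j")
      (simp_all add: w xy[symmetric] koszul_sign_def)
qed (auto simp: bider_simps[OF G] Der_simps[OF \<eta>] algebra_simps)

end

section \<open>The simply connected case\<close>

locale simply_connected_minimal_algebra = sullivan_minimal_algebra s V d
  for s :: "rat \<Rightarrow> 'a::ring_1 \<Rightarrow> 'a" and V :: "int \<Rightarrow> 'a set" and d :: "'a \<Rightarrow> 'a" +
  assumes simply_connected: "n < 2 \<Longrightarrow> V n = {0}"
begin

section \<open>Low degrees and the differential of generators\<close>

lemmas d_simps = Der_simps[OF d_derivation]

lemma d_degree: "a \<in> Lam_degree s V n \<Longrightarrow> d a \<in> Lam_degree s V (n + 1)"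
  using Der_degree[OF d_derivation] by force

lemma d_mult: "a \<in> Lam_degree s V n \<Longrightarrow> d (a * b) = d a * b + koszul_sign 1 n * a * d b"
  using Der_mult[OF d_derivation, of a n b] by (simp add: koszul_sign_def)

lemma D_apply: "D d k \<theta> x = d (\<theta> x) - koszul_sign 1 k * \<theta> (d x)"
  by (simp add: D_def bracket_def koszul_sign_def)

text \<open>A letter of degree below \<open>n\<close> is 0 and would kill the product.\<close>

lemma word_degree_ge:
  assumes low: "\<And>j. j < n \<Longrightarrow> V j = {0}" and "w \<in> words V" "word_prod w \<noteq> 0"
  shows "int (length w) * n \<le> word_degree w" "\<And>l. l \<in> set w \<Longrightarrow> n \<le> fst l"
proof -
  show 1: "n \<le> fst l" if "l \<in> set w" for l
  proof (rule ccontr)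
    assume "\<not> n \<le> fst l"
    then have "V (fst l) = {0}" using low by simp
    moreover have "snd l \<in> V (fst l)" using that assms(2) by (auto simp: words_def)
    ultimately have "(fst l, 0) \<in> set w" using that by (metis prod.collapse singletonD)
    then show False using assms(3) word_prod_zero by blast
  qed
  then show "int (length w) * n \<le> word_degree w"
  proof (induction w)
    case (Cons l w)
    have "n \<le> fst l" "int (length w) * n \<le> word_degree w"
      using Cons by auto
    then show ?case by (simp add: algebra_simps)
  qed simp
qed

lemma Lam_degree_eq_0:
  assumes low: "\<And>j. j < n \<Longrightarrow> V j = {0}" and "a \<in> Lam_degree s V i" "0 < i" "i < n"
  shows "a = 0"
  using assms(2) unfolding Lam_degree_iff
proof (induction rule: word_span_induct)
  case (word w)
  show ?case
  proof (rule ccontr)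
    assume "word_prod w \<noteq> 0"
    from word_degree_ge(1)[of n, OF low word(1) this] word(2) assms(3,4)
    have "int (length w) * n \<le> i" by simp
    moreover have "w \<noteq> []" using word assms(3) by auto
    then have "1 * n \<le> int (length w) * n"
      using assms(3,4) by (intro mult_right_mono) (auto simp: Suc_le_eq)
    ultimately show False using assms(4) by simp
  qed
qed auto

lemma Lam_degree_0:
  assumes "a \<in> Lam_degree s V 0"
  shows "a = s (aug a) 1"
  using assms unfolding Lam_degree_iff
proof (induction rule: word_span_induct)
  case (word w)
  have "w = []" if "word_prod w \<noteq> 0"
    using word_degree_ge(1)[of 2, OF simply_connected word(1) that] word(2) by simp
  then show ?case by (cases "word_prod w = 0") auto
next
  case (scale c a)
  then show ?case by (metis aug_simps(2) scale_scale)
qed (auto simp: scale_left_distrib)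

text \<open>A letter of \<open>d x\<close> shares the degree \<open>j + 1\<close> with at least one
  other letter, which takes up 2 or more. This strict drop drives the induction on degree.\<close>

lemma d_V:
  assumes "x \<in> V j"
  shows "d x \<in> word_span (\<lambda>w. 2 \<le> length w \<and> word_degree w = j + 1 \<and> (\<forall>l\<in>set w. fst l < j))"
    (is "_ \<in> word_span ?P")
proof -
  have "d x \<in> word_span (\<lambda>w. 2 \<le> length w)"
    using decomposable[OF assms]
  proof (induction rule: span_induct_alt)
    case (step c x y)
    then obtain l where "2 \<le> l" "x \<in> word_span (\<lambda>w. length w = l)"
      by (auto simp: Lam_length_def)
    then have "x \<in> word_span (\<lambda>w. 2 \<le> length w)"
      by (auto elim!: subsetD[OF span_mono, rotated])
    with step show ?case by (simp add: span_add span_scale)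
  qed (simp add: span_zero)
  from word_span_degree[OF this d_degree[OF V_in_Lam_degree[OF assms]]]
  show ?thesis
  proof (induction rule: word_span_induct)
    case (word w)
    show ?case
    proof (cases "word_prod w = 0")
      case False
      note ge = word_degree_ge[of 2, OF simply_connected word(1) False]
      have "fst l < j" if l: "l \<in> set w" for l
      proof -
        obtain u v where w: "w = u @ l # v" using split_list[OF l] by blast
        then have "word_prod u \<noteq> 0" "word_prod v \<noteq> 0" "u \<in> words V" "v \<in> words V"
          using False word by auto
        then have "2 * int (length u) \<le> word_degree u" "2 * int (length v) \<le> word_degree v"
          using word_degree_ge(1)[of 2, OF simply_connected] by (auto simp: mult.commute)
        then show ?thesis using word(2) w by auto
      qed
      then show ?thesis using word by (auto intro!: span_base)
    qed (simp add: span_zero)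
  qed (auto intro: span_zero span_add span_scale)
qed

lemma d_V_decomposable: "x \<in> V j \<Longrightarrow> d x \<in> word_span (\<lambda>w. 2 \<le> length w)"
  by (rule subsetD[OF span_mono d_V]) auto

text \<open>Words in \<open>d x\<close> have only letters of degree below \<open>n\<close>, so they
  vanish.\<close>

lemma d_lowest:
  assumes low: "\<And>j. j < n \<Longrightarrow> V j = {0}" and "x \<in> V n"
  shows "d x = 0"
  using d_V[OF assms(2)]
proof (induction rule: word_span_induct)
  case (word w)
  then obtain l where "l \<in> set w" by (cases w) auto
  then have "fst l < n" using word(2) by blast
  then show ?case using word_degree_ge(2)[of n, OF low word(1)] \<open>l \<in> set w\<close> by fastforce
qed auto

text \<open>Minimality makes \<open>d\<close> of a generator decomposable; the Leibniz rule does the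
  rest.\<close>

lemma aug_d: "aug (d a) = 0"
proof (induction a rule: word_induct)
  case (word w)
  show ?case
  proof (cases w)
    case (Cons l u)
    then have l: "snd l \<in> V (fst l)" using word by simp
    then show ?thesis
      using aug_decomposable[OF d_V_decomposable[OF l]]
      by (simp add: Cons d_mult[OF V_in_Lam_degree[OF l]] aug_V[OF l] mult.assoc)
  qed (use Der_one[OF d_derivation] in simp)
qed (auto simp: d_simps)

text \<open>For cycles \<open>a\<close> and \<open>\<theta>\<close> this makes the product a cycle,
  to which \<open>condition_G\<close> can be applied.\<close>

lemma D_smult:
  assumes "a \<in> Lam_degree s V i"
  shows "D d (k - i) (\<lambda>b. a * \<theta> b) x = d a * \<theta> x + koszul_sign 1 i * a * D d k \<theta> x"
  by (cases "even k"; cases "even i")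
    (simp_all add: D_apply d_mult[OF assms] koszul_sign_def algebra_simps)

section \<open>Exactness and boundaries\<close>

text \<open>\<open>condition_G\<close> in terms of \<open>aug\<close>. For \<open>1 \<le> k\<close>
  the primitive lies in degree above 1, where \<open>Der'\<close> is all of
  \<open>Der\<close>.\<close>

lemma exact_if_aug_eq_0:
  assumes "condition_G s V d k" "1 \<le> k" "\<theta> \<in> Der s V k" "\<And>x. D d k \<theta> x = 0" "\<And>x. aug (\<theta> x) = 0"
  obtains \<eta> where "\<eta> \<in> Der s V (k + 1)" "D d (k + 1) \<eta> = \<theta>"
proof -
  have "D d k \<theta> = (\<lambda>_. 0)"
    using assms(4) by blast
  moreover from this have "\<theta> \<in> Der' s V d k"
    using assms(2,3) by (auto simp: Der'_def)
  moreover have "L s V (-1) \<theta> = (\<lambda>_. 0)"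
    by (rule ext) (simp add: L_def length_component_0 assms(5))
  ultimately obtain \<eta> where "\<eta> \<in> Der' s V d (k + 1)" "D d (k + 1) \<eta> = \<theta>"
    using assms(1) unfolding condition_G_def by blast
  then show ?thesis
    using that assms(2) by (auto simp: Der'_def)
qed

text \<open>
  Boundaries have vanishing \<open>L\<^sub>-\<^sub>1\<close>; here this is applied to \<open>D [\<psi>, \<phi>] = [D \<psi>, \<phi>] \<plusminus> [\<psi>, D \<phi>]\<close>, in which
  two of the four terms vanish under the augmentation.
\<close>

lemma aug_bracket_boundary:
  assumes \<psi>: "\<psi> \<in> Der s V r" "\<And>x. aug (D d r \<psi> x) = 0"
    and \<phi>: "\<phi> \<in> Der s V k" "\<And>x. aug (D d k \<phi> x) = 0"
  obtains c where "\<And>j x. x \<in> V j \<Longrightarrow> aug (\<psi> (D d k \<phi> x)) = c * aug (\<phi> (D d r \<psi> x))"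
proof -
  \<comment> \<open>The term \<open>d (\<theta> x)\<close> of \<open>D d m \<theta> x\<close> is
    killed by \<open>aug\<close> anyway, so the other term is too.\<close>
  have cycle: "aug (\<theta> (d x)) = 0" if "\<theta> \<in> Der s V m" "\<And>x. aug (D d m \<theta> x) = 0" for \<theta> m x
    using that(2)[of x] by (auto simp: D_apply aug_d koszul_sign_def split: if_splits)
  have "aug (\<psi> (D d k \<phi> x)) =
      koszul_sign 1 k * koszul_sign r k * koszul_sign 1 r * aug (\<phi> (D d r \<psi> x))"
    if "x \<in> V j" for j x
  proof -
    \<comment> \<open>The bracket is a derivation and \<open>d x\<close> is decomposable.\<close>
    have "aug (bracket r k \<psi> \<phi> (d x)) = 0"
      by (rule aug_Der_decomposable[OF Der_bracket[OF \<psi>(1) \<phi>(1)] d_V_decomposable[OF that]])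
    then have "aug (\<psi> (\<phi> (d x))) = koszul_sign r k * aug (\<phi> (\<psi> (d x)))"
      by (simp add: bracket_def)
    moreover have "aug (\<psi> (D d k \<phi> x)) = - (koszul_sign 1 k * aug (\<psi> (\<phi> (d x))))"
      by (simp add: D_apply Der_simps[OF \<psi>(1)] cycle[OF \<psi>])
    moreover have "aug (\<phi> (D d r \<psi> x)) = - (koszul_sign 1 r * aug (\<phi> (\<psi> (d x))))"
      by (simp add: D_apply Der_simps[OF \<phi>(1)] cycle[OF \<phi>])
    ultimately show ?thesis
      by (simp add: koszul_sign_def)
  qed
  then show ?thesis by (rule that)
qed

section \<open>Extending a chain map degree by degree\<close>

text \<open>Stated at a single element because the construction of \<open>G\<close> secures
  compatibility with the differentials one degree at a time.\<close>

definition chain_at :: "int \<Rightarrow> ('a \<Rightarrow> 'a \<Rightarrow> 'a) \<Rightarrow> int \<Rightarrow> 'a \<Rightarrow> bool" where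
  "chain_at N G i a \<longleftrightarrow> (\<forall>b. D d (N - i) (G a) b = koszul_sign 1 N * G (d a) b)"

text \<open>Both sides obey the same Leibniz rule; the parity cases only verify its signs.\<close>

lemma chain_at_mult:
  assumes G: "bider N G" and a: "a \<in> Lam_degree s V i" "chain_at N G i a"
    and b: "b \<in> Lam_degree s V j" "chain_at N G j b"
  shows "chain_at N G (i + j) (a * b)"
proof -
  have a': "d (G a x) = koszul_sign 1 (N - i) * G a (d x) + koszul_sign 1 N * G (d a) x" for x
    using a(2) by (simp add: chain_at_def D_apply algebra_simps)
  have b': "d (G b x) = koszul_sign 1 (N - j) * G b (d x) + koszul_sign 1 N * G (d b) x" for x
    using b(2) by (simp add: chain_at_def D_apply algebra_simps)
  have "D d (N - (i + j)) (G (a * b)) x = koszul_sign 1 N * G (d (a * b)) x" for x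
    unfolding D_apply bider_mult[OF G a(1) b(1)] d_mult[OF a(1)] bider_simps[OF G] mult.assoc
      d_simps d_mult[OF b(1)] bider_mult[OF G d_degree[OF a(1)] b(1)] a' b'
      bider_mult[OF G a(1) d_degree[OF b(1)]]
    by (cases "even N"; cases "even i"; cases "even j")
      (simp_all add: koszul_sign_def algebra_simps)
  then show ?thesis by (simp add: chain_at_def)
qed

lemma chain_at_word:
  assumes G: "bider N G" and w: "w \<in> words V" "\<And>l. l \<in> set w \<Longrightarrow> chain_at N G (fst l) (snd l)"
  shows "chain_at N G (word_degree w) (word_prod w)"
  using w
proof (induction w)
  case Nil
  then show ?case
    by (simp add: chain_at_def D_apply bider_simps[OF G] Der_one[OF d_derivation] d_simps)
next
  case (Cons l w)
  then have "chain_at N G (fst l + word_degree w) (snd l * word_prod w)"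
    by (intro chain_at_mult[OF G]) (auto intro: V_in_Lam_degree word_in_Lam_degree)
  then show ?case by simp
qed

lemma chain_at_word_span:
  assumes G: "bider N G" and "a \<in> word_span (\<lambda>w. word_degree w = i \<and> (\<forall>l\<in>set w. fst l < m))"
    and V: "\<And>j x. x \<in> V j \<Longrightarrow> j < m \<Longrightarrow> chain_at N G j x"
  shows "chain_at N G i a"
  using assms(2)
proof (induction rule: word_span_induct)
  case (word w)
  have "chain_at N G (fst l) (snd l)" if "l \<in> set w" for l
    using that word V[of "snd l" "fst l"] by (auto simp: words_def)
  with chain_at_word[OF G word(1)] word(2) show ?case by blast
qed (auto simp: chain_at_def D_apply bider_simps[OF G] d_simps algebra_simps
    scale_right_diff_distrib scale_mult_right)

lemma bider_agree_word_span:
  assumes G: "bider N G" "bider N G'"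
    and "a \<in> word_span (\<lambda>w. \<forall>l\<in>set w. fst l < m)"
    and V: "\<And>j x. x \<in> V j \<Longrightarrow> j < m \<Longrightarrow> G x = G' x"
  shows "G a b = G' a b"
  using assms(3)
proof (induction rule: word_span_induct)
  case (word w)
  have "G (snd l) = G' (snd l)" if "l \<in> set w" for l
    using that word V[of "snd l" "fst l"] by (auto simp: words_def)
  then show ?case
    using bider_agree[OF G _ word(1)] by simp
qed (auto simp: bider_simps[OF G(1)] bider_simps[OF G(2)])

text \<open>Obstruction theory: \<open>G\<close> extends over \<open>V m\<close> once each
  \<open>G (d x)\<close>, a derivation of degree \<open>N - m - 1\<close>, is a boundary. It is a
  cycle with vanishing augmentation, so \<open>condition_G\<close> applies, and
  \<open>m + 2 \<le> N\<close> makes its degree positive.\<close>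

lemma extension_step:
  assumes G: "bider N G" "\<And>j x. x \<in> V j \<Longrightarrow> G x \<in> Der s V (N - j)"
    and chain: "\<And>j x. x \<in> V j \<Longrightarrow> j < m \<Longrightarrow> chain_at N G j x"
    and cond: "condition_G s V d (N - m - 1)" "m + 2 \<le> N"
  obtains G' where "bider N G'" "\<And>j x. x \<in> V j \<Longrightarrow> G' x \<in> Der s V (N - j)"
    "\<And>j x. x \<in> V j \<Longrightarrow> j \<noteq> m \<Longrightarrow> G' x = G x"
    "\<And>j x. x \<in> V j \<Longrightarrow> j \<le> m \<Longrightarrow> chain_at N G' j x"
proof -
  have "\<forall>x\<in>V m. \<exists>\<eta>. \<eta> \<in> Der s V (N - m) \<and>
      (\<forall>b. D d (N - m) \<eta> b = koszul_sign 1 N * G (d x) b)"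
  proof
    fix x assume x: "x \<in> V m"
    have dx: "d x \<in> Lam_degree s V (m + 1)"
      by (rule d_degree[OF V_in_Lam_degree[OF x]])
    have "G (d x) \<in> Der s V (N - (m + 1))"
      by (rule bider_in_Der[OF G dx])
    then have "(\<lambda>b. koszul_sign 1 N * G (d x) b) \<in> Der s V (N - m - 1)"
      by (simp add: Der_koszul_sign diff_diff_eq)
    \<comment> \<open>\<open>d x\<close> involves only generators below \<open>m\<close>, where
      \<open>G\<close> is compatible already; with \<open>d_squared\<close> this makes
      \<open>G (d x)\<close> a cycle.\<close>
    moreover have "chain_at N G (m + 1) (d x)"
      by (rule chain_at_word_span[OF G(1) subsetD[OF span_mono d_V[OF x]] chain]) auto
    then have "D d (N - m - 1) (\<lambda>b. koszul_sign 1 N * G (d x) b) b = 0" for b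
      by (simp add: chain_at_def D_apply d_squared bider_simps[OF G(1)] diff_diff_eq koszul_sign_def
          d_simps)
    moreover have "aug (koszul_sign 1 N * G (d x) b) = 0" for b
      using aug_bider_decomposable[OF G(1) d_V_decomposable[OF x]] by simp
    moreover have "1 \<le> N - m - 1"
      using cond(2) by simp
    ultimately obtain \<eta> where "\<eta> \<in> Der s V (N - m - 1 + 1)"
      "D d (N - m - 1 + 1) \<eta> = (\<lambda>b. koszul_sign 1 N * G (d x) b)"
      using exact_if_aug_eq_0[OF cond(1)] by metis
    then show "\<exists>\<eta>. \<eta> \<in> Der s V (N - m) \<and>
        (\<forall>b. D d (N - m) \<eta> b = koszul_sign 1 N * G (d x) b)"
      by (intro exI[of _ \<eta>]) simp_all
  qed
  from bchoice[OF this] obtain \<eta> where "\<forall>x\<in>V m. \<eta> x \<in> Der s V (N - m) \<and>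
      (\<forall>b. D d (N - m) (\<eta> x) b = koszul_sign 1 N * G (d x) b)" ..
  then have \<eta>: "\<And>x. x \<in> V m \<Longrightarrow> \<eta> x \<in> Der s V (N - m)"
    "\<And>x b. x \<in> V m \<Longrightarrow> D d (N - m) (\<eta> x) b = koszul_sign 1 N * G (d x) b"
    by simp_all
  \<comment> \<open>The chosen primitives need not depend linearly on \<open>x\<close>, so they are
    kept on a basis only and extended linearly.\<close>
  obtain B where B: "B \<subseteq> V m" "independent B" "V m \<subseteq> span B"
    by (rule basis_exists[of "V m"])
  interpret P: vector_space_pair s s ..
  have "\<exists>F. Vector_Spaces.linear s s F \<and> (\<forall>x\<in>B. F x = \<eta> x b)" for b
    by (rule P.linear_independent_extend[OF B(2)])
  then obtain F where F: "\<And>b. Vector_Spaces.linear s s (F b)" "\<And>b x. x \<in> B \<Longrightarrow> F b x = \<eta> x b"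
    by metis
  define g where "g j x b = (if j = m then F b x else G x b)" for j x b
  have "Vector_Spaces.linear s s (\<lambda>x. g j x b)" for j b
    using F(1) bider_linear[OF G(1)] by (cases "j = m") (simp_all add: g_def)
  from bider_extension[of g N, OF this] obtain G' where G': "bider N G'"
    "\<And>j x b. x \<in> V j \<Longrightarrow> G' x b = g j x b" by metis
  have old: "G' x = G x" if "x \<in> V j" "j \<noteq> m" for j x
    using G'(2)[OF that(1)] that(2) by (auto simp: g_def)
  have new: "G' x \<in> Der s V (N - m) \<and> (\<forall>b. D d (N - m) (G' x) b = koszul_sign 1 N * G (d x) b)"
    if "x \<in> V m" for x
  proof -
    have "x \<in> span B" using that B by blast
    then show ?thesis
    proof (induction rule: span_induct_alt)
      case base
      have "G' 0 = (\<lambda>_. 0)" by (rule ext) (simp add: bider_simps[OF G'(1)])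
      then show ?case by (simp add: Der_zero D_apply d_simps bider_simps[OF G(1)])
    next
      case (step c x y)
      then have x: "x \<in> V m" using B by blast
      have "G' x = \<eta> x"
        by (rule ext) (simp add: G'(2)[OF x] g_def F(2)[OF step(1)])
      with \<eta>[OF x] have x': "G' x \<in> Der s V (N - m)"
        "\<And>b. D d (N - m) (G' x) b = koszul_sign 1 N * G (d x) b" by auto
      have "G' (s c x + y) = (\<lambda>b. s c (G' x b) + G' y b)"
        by (rule ext) (simp add: bider_simps[OF G'(1)])
      moreover have "D d (N - m) (\<lambda>b. s c (G' x b) + G' y b) b =
          s c (D d (N - m) (G' x) b) + D d (N - m) (G' y) b" for b
        by (simp add: D_apply d_simps scale_right_diff_distrib scale_mult_right algebra_simps)
      ultimately show ?case
        using step x' by (simp add: Der_add Der_scale bider_simps[OF G(1)] d_simps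
            scale_mult_right distrib_left)
    qed
  qed
  \<comment> \<open>Changing the values on \<open>V m\<close> does not affect \<open>d x\<close>,
    whose letters lie below \<open>m\<close>.\<close>
  have agree: "G' (d x) b = G (d x) b" if "x \<in> V j" "j \<le> m" for x j b
  proof -
    have "d x \<in> word_span (\<lambda>w. \<forall>l\<in>set w. fst l < m)"
      by (rule subsetD[OF span_mono[OF image_mono] d_V[OF that(1)]]) (use that(2) in force)
    then show ?thesis
      by (rule bider_agree_word_span[OF G'(1) G(1)]) (use old in blast)
  qed
  show ?thesis
  proof (rule that[OF G'(1)])
    show "G' x \<in> Der s V (N - j)" if "x \<in> V j" for j x
      using new[of x] old[OF that] G(2)[OF that] that by (cases "j = m") auto
    show "G' x = G x" if "x \<in> V j" "j \<noteq> m" for j x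
      using old that by blast
    show "chain_at N G' j x" if "x \<in> V j" "j \<le> m" for j x
      using new[of x] old[OF that(1)] chain[OF that(1)] that agree[OF that]
      by (cases "j = m") (auto simp: chain_at_def)
  qed
qed

section \<open>Proportionality of the two cycles\<close>

text \<open>The factor is 0 when \<open>p\<close> is the lowest degree of \<open>V\<close>;
  otherwise it is a multiple of \<open>aug (G v x)\<close>.\<close>

lemma cycles_proportional:
  assumes \<theta>1: "\<theta>1 \<in> Der s V p" "\<And>x. D d p \<theta>1 x = 0"
    and \<theta>2: "\<theta>2 \<in> Der s V q" "\<And>x. D d q \<theta>2 x = 0"
    and v: "v \<in> V p" "aug (\<theta>1 v) = 1" and "p \<le> q"
    and G1: "\<And>k. 1 \<le> k \<Longrightarrow> k \<le> p - 2 \<Longrightarrow> condition_G s V d k"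
    and G2: "\<And>k. q - p \<le> k \<Longrightarrow> k \<le> q - 2 \<Longrightarrow> condition_G s V d k"
    and not_conclusion: "\<not> (p = q \<and> (\<forall>n<p. V n = {0}))"
  shows "\<exists>c. \<forall>j. \<forall>w\<in>V j. aug (\<theta>2 w) = c * aug (\<theta>1 w)"
proof -
  have "v \<noteq> 0" using v Der_simps[OF \<theta>1(1)] by auto
  with v(1) have Vp: "V p \<noteq> {0}" by auto
  then have p: "2 \<le> p" using simply_connected by force
  then have "\<exists>m. V (int m) \<noteq> {0}" using Vp by (intro exI[of _ "nat p"]) simp
  then obtain m where m: "V (int m) \<noteq> {0}" "\<And>i. i < m \<Longrightarrow> V (int i) = {0}"
    using exists_least_iff[of "\<lambda>m. V (int m) \<noteq> {0}"] by auto
  define n where "n = int m"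
  have low: "V j = {0}" if "j < n" for j
    using m(2)[of "nat j"] that simply_connected[of j] by (cases "j < 0") (auto simp: n_def)
  have n: "2 \<le> n" "n \<le> p" using m(1) simply_connected low Vp by (force simp: n_def)+
  show ?thesis
  proof (cases "n = p")
    case True
    \<comment> \<open>With nothing below \<open>p\<close>, only \<open>p = q\<close> could fail.
      Hence \<open>q - p\<close> is positive, and it lies in the range of \<open>G2\<close> since
      \<open>2 \<le> p\<close>.\<close>
    with low not_conclusion \<open>p \<le> q\<close> have "p < q" by force
    have v': "v \<in> Lam_degree s V p" "d v = 0"
      using V_in_Lam_degree v(1) d_lowest[OF low] True by auto
    obtain \<omega> where \<omega>: "\<omega> \<in> Der s V (q - p + 1)" "D d (q - p + 1) \<omega> = (\<lambda>b. v * \<theta>2 b)"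
    proof (rule exact_if_aug_eq_0)
      show "condition_G s V d (q - p)" using G2 p by simp
      show "1 \<le> q - p" using \<open>p < q\<close> by simp
      show "(\<lambda>b. v * \<theta>2 b) \<in> Der s V (q - p)" by (rule Der_smult[OF v'(1) \<theta>2(1)])
      show "D d (q - p) (\<lambda>b. v * \<theta>2 b) x = 0" for x
        by (simp add: D_smult[OF v'(1)] v'(2) \<theta>2(2))
      show "aug (v * \<theta>2 b) = 0" for b by (simp add: aug_V[OF v(1)])
    qed
    \<comment> \<open>The right side vanishes as \<open>\<theta>1\<close> is a cycle; the left is
      \<open>aug (\<theta>1 (v * \<theta>2 x))\<close>, that is,
      \<open>aug (\<theta>2 x)\<close>.\<close>
    obtain c where c: "\<And>j x. x \<in> V j \<Longrightarrow>
        aug (\<theta>1 (D d (q - p + 1) \<omega> x)) = c * aug (\<omega> (D d p \<theta>1 x))"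
      by (rule aug_bracket_boundary[OF \<theta>1(1) _ \<omega>(1)])
        (auto simp: \<theta>1(2) \<omega>(2) aug_V[OF v(1)])
    have "aug (\<theta>2 w) = 0" if "w \<in> V j" for w j
      using c[OF that] by (simp add: \<omega>(2) \<theta>1(2) Der_mult[OF \<theta>1(1) v'(1)] v(2) aug_V[OF v(1)]
          Der_simps[OF \<omega>(1)] mult.assoc)
    then show ?thesis by (intro exI[of _ 0]) auto
  next
    case False
    with n have "n < p" by simp
    have "0 \<in> V n" using subspace_0[OF subspace_V] .
    then obtain x where x: "x \<in> V n" "x \<noteq> 0" using m(1) n_def by blast
    have x': "x \<in> Lam_degree s V n" "d x = 0"
      using V_in_Lam_degree x(1) d_lowest[OF low] by auto
    \<comment> \<open>The degree of a primitive of \<open>x * \<theta>1\<close>; the cycle itself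
      has degree \<open>p - n\<close>, which is at most \<open>p - 2\<close> because
      \<open>2 \<le> n\<close>.\<close>
    define r where "r = p - n + 1"
    obtain \<eta> where \<eta>: "\<eta> \<in> Der s V r" "D d r \<eta> = (\<lambda>b. x * \<theta>1 b)"
      unfolding r_def
    proof (rule exact_if_aug_eq_0)
      show "condition_G s V d (p - n)" "1 \<le> p - n" using G1 n \<open>n < p\<close> by simp_all
      show "(\<lambda>b. x * \<theta>1 b) \<in> Der s V (p - n)" by (rule Der_smult[OF x'(1) \<theta>1(1)])
      show "D d (p - n) (\<lambda>b. x * \<theta>1 b) b = 0" for b
        by (simp add: D_smult[OF x'(1)] x'(2) \<theta>1(2))
      show "aug (x * \<theta>1 b) = 0" for b by (simp add: aug_V[OF x(1)])
    qed
    interpret Q: vector_space "(*) :: rat \<Rightarrow> rat \<Rightarrow> rat"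
      by unfold_locales (auto simp: algebra_simps)
    interpret P: vector_space_pair s "(*) :: rat \<Rightarrow> rat \<Rightarrow> rat" ..
    have "\<exists>\<chi>. Vector_Spaces.linear s (*) \<chi> \<and> (\<forall>y\<in>{x}. \<chi> y = (1::rat))"
      by (rule P.linear_independent_extend) (use x(2) in simp)
    then obtain \<chi> where \<chi>: "Vector_Spaces.linear s (*) \<chi>" "\<chi> x = (1::rat)" by blast
    interpret \<chi>: Vector_Spaces.linear s "(*)" \<chi> by (rule \<chi>(1))
    \<comment> \<open>Chosen so that \<open>G\<close> sends \<open>V n\<close> to derivations of
      degree \<open>N - n = q\<close>, the degree of \<open>\<theta>2\<close>.\<close>
    define N where "N = q + n"
    define g where "g j y b = (if j = n then s (\<chi> y) (\<theta>2 b) else 0)" for j y b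
    have "Vector_Spaces.linear s s (\<lambda>y. g j y b)" for j b
      by unfold_locales (auto simp: g_def \<chi>.add \<chi>.scale scale_left_distrib)
    from bider_extension[of g N, OF this] obtain G0 where G0: "bider N G0"
      "\<And>j y b. y \<in> V j \<Longrightarrow> G0 y b = g j y b" by metis
    define P where "P k G \<longleftrightarrow> bider N G \<and> (\<forall>j. \<forall>y\<in>V j. G y \<in> Der s V (N - j)) \<and>
        (\<forall>y\<in>V n. G y = (\<lambda>b. s (\<chi> y) (\<theta>2 b))) \<and> (\<forall>j\<le>k. \<forall>y\<in>V j. chain_at N G j y)" for k G
    have ind: "k \<le> p \<longrightarrow> (\<exists>G. P k G)" if "n \<le> k" for k
      using that
    proof (induction k rule: int_ge_induct)
      case base
      have G0n: "G0 y = (\<lambda>b. s (\<chi> y) (\<theta>2 b))" if "y \<in> V n" for y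
        by (rule ext) (simp add: G0(2)[OF that] g_def)
      have G0j: "G0 y = (\<lambda>b. 0)" if "y \<in> V j" "j \<noteq> n" for y j
        by (rule ext) (simp add: G0(2)[OF that(1)] g_def that(2))
      have "G0 y \<in> Der s V (N - j)" if "y \<in> V j" for y j
        using that G0n G0j[OF that] Der_scale[OF \<theta>2(1)] Der_zero by (cases "j = n") (auto simp: N_def)
      \<comment> \<open>In degree \<open>n\<close> the differential vanishes, so the claim is that
        \<open>\<theta>2\<close> is a cycle; below \<open>n\<close> there are no generators.\<close>
      moreover have "chain_at N G0 j y" if "y \<in> V j" "j \<le> n" for y j
      proof (cases "j = n")
        case True
        then have "d y = 0" using d_lowest[OF low] that(1) by blast
        moreover have "s c (d (\<theta>2 b)) - koszul_sign 1 q * s c (\<theta>2 (d b)) = 0" for c b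
          using arg_cong[OF \<theta>2(2)[of b], of "s c"]
          by (simp add: D_apply scale_right_diff_distrib scale_mult_right)
        ultimately show ?thesis
          using G0n that(1) True by (simp add: chain_at_def bider_simps[OF G0(1)] D_apply N_def d_simps)
      next
        case False
        then have "y = 0" using low[of j] that by auto
        then show ?thesis by (simp add: chain_at_def bider_simps[OF G0(1)] D_apply d_simps)
      qed
      ultimately have "P n G0" using G0(1) G0n by (simp add: P_def)
      then show ?case by blast
    next
      case (step k)
      show ?case
      proof
        assume k: "k + 1 \<le> p"
        with step obtain G where "P k G" by auto
        then have G: "bider N G" "\<And>j y. y \<in> V j \<Longrightarrow> G y \<in> Der s V (N - j)"
          "\<And>y. y \<in> V n \<Longrightarrow> G y = (\<lambda>b. s (\<chi> y) (\<theta>2 b))"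
          "\<And>j y. y \<in> V j \<Longrightarrow> j \<le> k \<Longrightarrow> chain_at N G j y"
          by (simp_all add: P_def)
        obtain G' where "bider N G'" "\<And>j y. y \<in> V j \<Longrightarrow> G' y \<in> Der s V (N - j)"
          "\<And>j y. y \<in> V j \<Longrightarrow> j \<noteq> k + 1 \<Longrightarrow> G' y = G y"
          "\<And>j y. y \<in> V j \<Longrightarrow> j \<le> k + 1 \<Longrightarrow> chain_at N G' j y"
        proof (rule extension_step[OF G(1,2), of "k + 1"])
          \<comment> \<open>This degree is \<open>q + n - k - 2\<close>. From
            \<open>n \<le> k < p\<close> and \<open>2 \<le> n\<close> it lies between
            \<open>q - p\<close> and \<open>q - 2\<close>.\<close>
          show "condition_G s V d (N - (k + 1) - 1)"
            using G2 n k step(1) by (simp add: N_def)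
          show "k + 1 + 2 \<le> N" using n k \<open>p \<le> q\<close> by (simp add: N_def)
        qed (use G(4) in auto)
        moreover have "n \<noteq> k + 1" using step(1) by simp
        ultimately have "P (k + 1) G'" using G(3) by (simp add: P_def)
        then show "\<exists>G. P (k + 1) G" by blast
      qed
    qed
    obtain G where "P p G" using ind[OF n(2)] by blast
    then have G: "bider N G" "\<And>j y. y \<in> V j \<Longrightarrow> G y \<in> Der s V (N - j)"
      "\<And>y. y \<in> V n \<Longrightarrow> G y = (\<lambda>b. s (\<chi> y) (\<theta>2 b))"
      "\<And>j y. y \<in> V j \<Longrightarrow> j \<le> p \<Longrightarrow> chain_at N G j y"
      by (simp_all add: P_def)
    have \<zeta>: "G v \<in> Der s V (N - p)" "\<And>b. D d (N - p) (G v) b = koszul_sign 1 N * G (d v) b"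
      using G(2)[OF v(1)] G(4)[OF v(1)] by (auto simp: chain_at_def)
    obtain c where c: "\<And>j y. y \<in> V j \<Longrightarrow>
        aug (\<eta> (D d (N - p) (G v) y)) = c * aug (G v (D d r \<eta> y))"
      by (rule aug_bracket_boundary[OF \<eta>(1) _ \<zeta>(1)])
        (auto simp: \<eta>(2) \<zeta>(2) aug_V[OF x(1)]
          aug_bider_decomposable[OF G(1) d_V_decomposable[OF v(1)]])
    have "\<theta>1 v = 1"
      using Lam_degree_0[of "\<theta>1 v"] Der_degree[OF \<theta>1(1) V_in_Lam_degree[OF v(1)]] v(2) by simp
    \<comment> \<open>\<open>\<eta> v\<close> has degree \<open>p - r = n - 1\<close>, strictly
      between 0 and the lowest degree \<open>n\<close>. Evaluating \<open>D d r \<eta>\<close> at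
      \<open>v\<close> therefore leaves only \<open>\<eta> (d v)\<close>.\<close>
    moreover have "\<eta> v = 0"
      by (rule Lam_degree_eq_0[of n _ "n - 1", OF low])
        (use Der_degree[OF \<eta>(1) V_in_Lam_degree[OF v(1)]] n in \<open>auto simp: r_def\<close>)
    ultimately have \<eta>dv: "\<eta> (d v) = - (koszul_sign 1 r * x)"
      using fun_cong[OF \<eta>(2), of v]
      by (auto simp: D_apply d_simps koszul_sign_def minus_equation_iff split: if_splits)
    have "aug (\<theta>2 w) = - (koszul_sign 1 N * koszul_sign N r * koszul_sign 1 r * c * aug (G v x))
        * aug (\<theta>1 w)" if w: "w \<in> V j" for j w
    proof -
      \<comment> \<open>Since \<open>d v\<close> is decomposable, \<open>\<eta>\<close> may be moved
        inside \<open>G\<close>, which gives \<open>G x\<close>, and this is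
        \<open>\<theta>2\<close> because \<open>\<chi> x = 1\<close>.\<close>
      have "aug (\<eta> (D d (N - p) (G v) w)) =
          - (koszul_sign 1 N * koszul_sign N r * koszul_sign 1 r * aug (\<theta>2 w))"
        using aug_Der_bider_decomposable[OF \<eta>(1) G(1) d_V_decomposable[OF v(1)], of w]
        by (simp add: \<zeta>(2) Der_simps[OF \<eta>(1)] \<eta>dv bider_simps[OF G(1)] G(3)[OF x(1)] \<chi>(2))
      moreover have "aug (G v (D d r \<eta> w)) = aug (G v x) * aug (\<theta>1 w)"
        by (simp add: \<eta>(2) Der_mult[OF \<zeta>(1) x'(1)] aug_V[OF x(1)] mult.assoc)
      ultimately show ?thesis
        using c[OF w] by (auto simp: koszul_sign_def)
    qed
    then show ?thesis by blast
  qed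
qed

section \<open>Back to linear independence\<close>

lemma L_minus_1: "L s V (-1) \<theta> v = (if v \<in> total_space s V then s (aug (\<theta> v)) 1 else 0)"
  by (simp add: L_def length_component_0)

lemma aug_total_space:
  assumes "\<theta>1 \<in> Der s V p" "\<theta>2 \<in> Der s V q" "v \<in> total_space s V"
    and "\<And>j w. w \<in> V j \<Longrightarrow> aug (\<theta>2 w) = c * aug (\<theta>1 w)"
  shows "aug (\<theta>2 v) = c * aug (\<theta>1 v)"
  using assms(3) unfolding total_space_def
  by (induction rule: span_induct_alt)
    (auto simp: Der_simps[OF assms(1)] Der_simps[OF assms(2)] assms(4) algebra_simps)

text \<open>Independence makes \<open>L s V (-1) \<theta>1\<close> nonzero, which supplies the
  normalized \<open>v\<close>; the proportionality then contradicts independence.\<close>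

lemma independent_cycles:
  assumes \<theta>1: "\<theta>1 \<in> Der' s V d p" "D d p \<theta>1 = (\<lambda>_. 0)"
    and \<theta>2: "\<theta>2 \<in> Der' s V d q" "D d q \<theta>2 = (\<lambda>_. 0)"
    and indep: "lin_indep_pair s (L s V (-1) \<theta>1) (L s V (-1) \<theta>2)" and "p \<le> q"
    and "\<And>k. 1 \<le> k \<Longrightarrow> k \<le> p - 2 \<Longrightarrow> condition_G s V d k"
    and "\<And>k. q - p \<le> k \<Longrightarrow> k \<le> q - 2 \<Longrightarrow> condition_G s V d k"
  shows "p = q \<and> (\<forall>n<p. V n = {0})"
proof (rule ccontr)
  assume contr: "\<not> ?thesis"
  have Der: "\<theta>1 \<in> Der s V p" "\<theta>2 \<in> Der s V q"
    using \<theta>1(1) \<theta>2(1) Der_zero by (auto simp: Der'_def split: if_splits)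
  have "\<exists>v\<in>V p. aug (\<theta>1 v) \<noteq> 0"
  proof (rule ccontr)
    assume "\<not> ?thesis"
    \<comment> \<open>Outside degree \<open>p\<close> the value \<open>\<theta>1 w\<close> has
      nonzero degree, so \<open>aug\<close> kills it. The factor 0 fits the shape of
      \<open>aug_total_space\<close>.\<close>
    then have "aug (\<theta>1 w) = 0 * aug (\<theta>1 w)" if "w \<in> V j" for j w
      using that aug_degree[OF Der_degree[OF Der(1) V_in_Lam_degree[OF that]]] by (cases "j = p") auto
    then have "L s V (-1) \<theta>1 = (\<lambda>_. 0)"
      using aug_total_space[OF Der(1) Der(1), of _ 0] by (auto simp: L_minus_1)
    then show False
      using indep[unfolded lin_indep_pair_def, rule_format, of 1 0] by simp
  qed
  then obtain v where v: "v \<in> V p" "aug (\<theta>1 v) \<noteq> 0" by blast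
  have "s (1 / aug (\<theta>1 v)) v \<in> V p" "aug (\<theta>1 (s (1 / aug (\<theta>1 v)) v)) = 1"
    using v subspace_scale[OF subspace_V] by (auto simp: Der_simps[OF Der(1)])
  from cycles_proportional[OF Der(1) fun_cong[OF \<theta>1(2)] Der(2) fun_cong[OF \<theta>2(2)] this
    \<open>p \<le> q\<close> assms(7,8) contr]
  obtain c where "\<And>j w. w \<in> V j \<Longrightarrow> aug (\<theta>2 w) = c * aug (\<theta>1 w)" by blast
  then have "(\<lambda>v. s (- c) (L s V (-1) \<theta>1 v) + s 1 (L s V (-1) \<theta>2 v)) = (\<lambda>_. 0)"
    using aug_total_space[OF Der, of _ c] by (auto simp: L_minus_1)
  then show False
    using indep[unfolded lin_indep_pair_def, rule_format, of "- c" 1] by simp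
qed

end

theorem lemma3p3:
  fixes s :: "rat \<Rightarrow> 'a::ring_1 \<Rightarrow> 'a"
    and V :: "int \<Rightarrow> 'a set"
    and d :: "'a \<Rightarrow> 'a"
    and \<theta>1 \<theta>2 :: "'a \<Rightarrow> 'a"
    and p q :: int
  assumes "sullivan_minimal_algebra s V d"
    and "\<And>n. n < 2 \<Longrightarrow> V n = {0}"
    and "finite_type s V"
    and "\<theta>1 \<in> Der' s V d p" and "D d p \<theta>1 = (\<lambda>_. 0)"
    and "\<theta>2 \<in> Der' s V d q" and "D d q \<theta>2 = (\<lambda>_. 0)"
    and "lin_indep_pair s (L s V (-1) \<theta>1) (L s V (-1) \<theta>2)"
    and "\<And>k. 1 \<le> k \<Longrightarrow> k \<le> p - 2 \<Longrightarrow> condition_G s V d k"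
    and "\<And>k. q - p \<le> k \<Longrightarrow> k \<le> q - 2 \<Longrightarrow> condition_G s V d k"
  shows "p = q \<and> (\<forall>n<p. V n = {0})"
proof -
  interpret sullivan_minimal_algebra s V d by (rule assms(1))
  interpret simply_connected_minimal_algebra s V d by unfold_locales (rule assms(2))
  show ?thesis
  proof (cases "p \<le> q")
    case True
    from independent_cycles[OF assms(4-8) True assms(9,10)] show ?thesis .
  next
    case False
    have "lin_indep_pair s (L s V (-1) \<theta>2) (L s V (-1) \<theta>1)"
      using assms(8) unfolding lin_indep_pair_def by (metis (no_types, lifting) add.commute ext)
    \<comment> \<open>For \<open>q < p\<close> the exchanged ranges start at 1 and at
      \<open>p - q\<close>, which is positive, and end at \<open>q - 2\<close> and
      \<open>p - 2\<close>; both lie within the range from 1 to \<open>p - 2\<close>.\<close>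
    from independent_cycles[OF assms(6,7,4,5) this] False assms(9) show ?thesis by force
  qed
qed

end
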